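(* Fix an integer $d\ge 3$, and let $K$ be a $(d-1)$-dimensional simplicial complex with $n$ vertices, identified with $[n]=\{1,\dots,n\}$. Then $K$ is volume-rigid if and only if $\{1,3,4,\dots,d,n\}\in\Delta^p(K)$.
   Context: Volume rigidity. Let $K$ be a $(d-1)$-dimensional simplicial complex with $n$ vertices. A map $\mathbf p:V(K)\to\mathbb R^{d-1}$ is generic if its $(d-1)n$ coordinates are algebraically independent over $\mathbb Q$. For a $(d-1)$-face $\sigma=\{v_1<\dots<v_d\}$ of $K$ (for a fixed total order on the vertices) let $M_{\mathbf p,\sigma}=\begin{pmatrix}\mathbf p(v_1)&\cdots&\mathbf p(v_d)\\1&\cdots&1\end{pmatrix}$, a $d\times d$ matrix. The volume-rigidity matrix $\mathfrak V(K,\mathbf p)$ is the $(d-1)n\times f_{d-1}(K)$ matrix ($f_{d-1}(K)$ is the number of $(d-1)$-faces of $K$) whose columns are indexed by the $(d-1)$-faces of $K$, whose rows are grouped in blocks of $d-1$ rows, one block per vertex, and whose column for $\sigma=\{v_1,\dots,v_d\}$ has as its $j$-th coordinate in the block of $v_i$ ($i\in[d]$, $j\in[d-1]$) the derivative of $\det M_{\mathbf p,\sigma}$ with respect to the $j$-th coordinate of $\mathbf p(v_i)$, i.e. the cofactor of $M_{\mathbf p,\sigma}$ at row $j$ and column $i$; all other entries are $0$. $K$ is volume-rigid if $\operatorname{rank}\mathfrak V(K,\mathbf p)=(d-1)n-(d^2-d-1)$ for a generic $\mathbf p:V(K)\to\mathbb R^{d-1}$. Shifting. Let $(e_i)_{i\in[n]}$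 be the standard basis of $\mathbb R^n$ and $(e_\sigma)_{\sigma\subseteq[n]}$ the induced basis of the exterior algebra $\bigwedge\mathbb R^n$. Let $(f_1,\dots,f_n)$ be a generic basis of $\mathbb R^n$ with $f_1=\mathbf 1$ (the all-ones vector), meaning that the $n^2-n$ coordinates of $f_2,\dots,f_n$ are algebraically independent over $\mathbb Q$; for $\sigma=\{\sigma_1<\dots<\sigma_m\}$ put $f_\sigma=f_{\sigma_1}\wedge\dots\wedge f_{\sigma_m}$. For a simplicial complex $K$ on $[n]$ let $\bigwedge K=\bigwedge\mathbb R^n/(e_\sigma:\sigma\notin K)$ with quotient map $q$. Let $\le_p$ be the partial order on subsets of $[n]$ with $\{\sigma_1<\dots<\sigma_m\}\le_p\{\tau_1<\dots<\tau_{m'}\}$ iff $m=m'$ and $\sigma_i\le\tau_i$ for all $i\in[m]$. Then $$\Delta^p(K)=\{\sigma\subseteq[n]: q(f_\sigma)\notin\operatorname{span}_{\mathbb R}\{q(f_\tau):\tau<_p\sigma,\ |\tau|=|\sigma|\}\}.$$ This does not depend on the choice of the generic basis. *)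

theory Defs
  imports
    "Jordan_Normal_Form.DL_Rank"
    "Jordan_Normal_Form.Determinant"
    "HOL-Library.Poly_Mapping"
    "HOL-Library.Function_Algebras"
begin

section \<open>Algebraic independence over the rationals\<close>

text \<open>Multivariate polynomials over the rationals, with variables indexed by the type \<open>'i\<close>, are
  finitely supported maps from monomials (themselves finitely supported maps from variables to
  exponents) to coefficients.\<close>

definition rat_poly_eval :: "('i \<Rightarrow> real) \<Rightarrow> (('i \<Rightarrow>\<^sub>0 nat) \<Rightarrow>\<^sub>0 rat) \<Rightarrow> real" where
  "rat_poly_eval x P =
    (\<Sum>m\<in>Poly_Mapping.keys P. of_rat (Poly_Mapping.lookup P m) *
      (\<Prod>i\<in>Poly_Mapping.keys m. x i ^ Poly_Mapping.lookup m i))"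

definition alg_indep_family :: "'i set \<Rightarrow> ('i \<Rightarrow> real) \<Rightarrow> bool" where
  "alg_indep_family I x \<longleftrightarrow>
    (\<forall>P. (\<forall>m\<in>Poly_Mapping.keys P. Poly_Mapping.keys m \<subseteq> I) \<and> rat_poly_eval x P = 0 \<longrightarrow> P = 0)"


section \<open>Simplicial complexes\<close>

definition simplicial_complex :: "nat \<Rightarrow> nat set set \<Rightarrow> bool" where
  "simplicial_complex n K \<longleftrightarrow>
    K \<subseteq> Pow {1..n} \<and> {} \<in> K \<and> (\<forall>v\<in>{1..n}. {v} \<in> K) \<and>
    (\<forall>\<sigma>\<in>K. \<forall>\<tau>. \<tau> \<subseteq> \<sigma> \<longrightarrow> \<tau> \<in> K)"

text \<open>The shift by one avoids truncated subtraction: dimension \<open>k\<close> means that the largest faces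
  have \<open>k + 1\<close> vertices.\<close>

definition has_dimension :: "nat set set \<Rightarrow> nat \<Rightarrow> bool" where
  "has_dimension K k \<longleftrightarrow> (\<exists>\<sigma>\<in>K. card \<sigma> = k + 1) \<and> (\<forall>\<sigma>\<in>K. card \<sigma> \<le> k + 1)"


section \<open>Volume rigidity\<close>

definition generic_map :: "nat \<Rightarrow> nat \<Rightarrow> (nat \<Rightarrow> real vec) \<Rightarrow> bool" where
  "generic_map d n p \<longleftrightarrow>
    (\<forall>v\<in>{1..n}. p v \<in> carrier_vec (d - 1)) \<and>
    alg_indep_family ({1..n} \<times> {..<d - 1}) (\<lambda>(v, j). p v $ j)"

text \<open>Faces of size \<open>d\<close> are given by their increasing vertex lists; \<open>subseqs [1..<Suc n]\<close> lists the
  increasing lists with entries in \<open>{1..n}\<close>, each exactly once.\<close>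

definition facet_lists :: "nat \<Rightarrow> nat \<Rightarrow> nat set set \<Rightarrow> nat list list" where
  "facet_lists d n K = filter (\<lambda>s. length s = d \<and> set s \<in> K) (subseqs [1..<Suc n])"

definition face_matrix :: "nat \<Rightarrow> (nat \<Rightarrow> real vec) \<Rightarrow> nat list \<Rightarrow> real mat" where
  "face_matrix d p s = mat d d (\<lambda>(j, i). if j < d - 1 then p (s ! i) $ j else 1)"

text \<open>The block of the vertex \<open>v \<in> {1..n}\<close> consists of the rows \<open>(v - 1) * (d - 1) + j\<close> with
  \<open>j < d - 1\<close>. Coordinates and list positions count from 0.\<close>

definition volume_rigidity_column :: "nat \<Rightarrow> nat \<Rightarrow> (nat \<Rightarrow> real vec) \<Rightarrow> nat list \<Rightarrow> real vec" where
  "volume_rigidity_column d n p s = vec ((d - 1) * n) (\<lambda>r.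
     let v = r div (d - 1) + 1; j = r mod (d - 1) in
       if v \<in> set s then cofactor (face_matrix d p s) j (THE i. i < d \<and> s ! i = v) else 0)"

definition volume_rigidity_matrix ::
    "nat \<Rightarrow> nat \<Rightarrow> nat set set \<Rightarrow> (nat \<Rightarrow> real vec) \<Rightarrow> real mat" where
  "volume_rigidity_matrix d n K p =
    mat_of_cols ((d - 1) * n) (map (volume_rigidity_column d n p) (facet_lists d n K))"

text \<open>The rank is the same for all generic \<open>p\<close>, so asking for one generic \<open>p\<close> or for all of them
  gives the same notion.\<close>

definition volume_rigid :: "nat \<Rightarrow> nat \<Rightarrow> nat set set \<Rightarrow> bool" where
  "volume_rigid d n K \<longleftrightarrow>
    (\<exists>p. generic_map d n p \<and>
      int (vec_space.rank ((d - 1) * n) (volume_rigidity_matrix d n K p)) =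
        (int d - 1) * int n - ((int d)\<^sup>2 - int d - 1))"


section \<open>The exterior algebra\<close>

text \<open>An element of the exterior algebra of \<open>\<real>\<^sup>n\<close> is represented by its coefficients with respect to
  the basis of the \<open>e\<^sub>S\<close>, \<open>S \<subseteq> {1..n}\<close>.\<close>

type_synonym ext_elem = "nat set \<Rightarrow> real"

definition ext_scale :: "real \<Rightarrow> ext_elem \<Rightarrow> ext_elem" where
  "ext_scale c x = (\<lambda>S. c * x S)"

global_interpretation ext: Vector_Spaces.vector_space ext_scale
  by unfold_locales (auto simp: ext_scale_def fun_eq_iff algebra_simps)

definition ext_carrier :: "nat \<Rightarrow> ext_elem set" where
  "ext_carrier n = {x. \<forall>S. x S \<noteq> 0 \<longrightarrow> S \<subseteq> {1..n}}"

definition ext_basis :: "nat set \<Rightarrow> ext_elem" where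
  "ext_basis S = (\<lambda>T. if T = S then 1 else 0)"

text \<open>Bilinear extension of \<open>e\<^sub>A \<and> e\<^sub>B = \<plusminus> e\<^bsub>A \<union> B\<^esub>\<close> for disjoint \<open>A\<close> and \<open>B\<close>, and \<open>0\<close> otherwise. The
  sign is that of the permutation which sorts the concatenation of \<open>A\<close> and \<open>B\<close>.\<close>

definition wedge :: "ext_elem \<Rightarrow> ext_elem \<Rightarrow> ext_elem" where
  "wedge x y = (\<lambda>S. \<Sum>A\<in>Pow S.
     (-1) ^ card {(i, j). i \<in> A \<and> j \<in> S - A \<and> j < i} * x A * y (S - A))"

text \<open>Sanity check for the formula: products of basis elements.\<close>

lemma wedge_ext_basis:
  assumes "finite A" "finite B"
  shows "wedge (ext_basis A) (ext_basis B) =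
    (if A \<inter> B = {}
     then ext_scale ((-1) ^ card {(i, j). i \<in> A \<and> j \<in> B \<and> j < i}) (ext_basis (A \<union> B)) else 0)"
proof
  fix S :: "nat set"
  let ?s = "\<lambda>C. (-1::real) ^ card {(i, j). i \<in> C \<and> j \<in> S - C \<and> j < i}"
  have eq: "wedge (ext_basis A) (ext_basis B) S =
      (\<Sum>C\<in>Pow S. if C = A then ?s A * ext_basis B (S - A) else 0)"
    unfolding wedge_def by (rule sum.cong) (auto simp: ext_basis_def)
  show "wedge (ext_basis A) (ext_basis B) S =
    (if A \<inter> B = {}
     then ext_scale ((-1) ^ card {(i, j). i \<in> A \<and> j \<in> B \<and> j < i}) (ext_basis (A \<union> B)) else 0) S"
  proof (cases "A \<subseteq> S \<and> S - A = B")
    case True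
    then have "S = A \<union> B" "A \<inter> B = {}" "finite S" using assms by auto
    then show ?thesis using True unfolding eq
      by (simp add: ext_basis_def ext_scale_def)
  next
    case False
    have "wedge (ext_basis A) (ext_basis B) S = 0"
      unfolding eq using False by (intro sum.neutral) (auto simp: ext_basis_def)
    moreover have "A \<inter> B = {} \<Longrightarrow> S \<noteq> A \<union> B" using False by auto
    ultimately show ?thesis by (auto simp: ext_basis_def ext_scale_def)
  qed
qed

definition ext_vector :: "nat \<Rightarrow> (nat \<Rightarrow> real) \<Rightarrow> ext_elem" where
  "ext_vector n a = (\<Sum>j\<in>{1..n}. ext_scale (a j) (ext_basis {j}))"

text \<open>\<open>f i j\<close> is the \<open>j\<close>-th coordinate of the vector \<open>f\<^sub>i\<close>, with \<open>i, j \<in> {1..n}\<close>. The empty wedge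
  product is the unit \<open>e\<^bsub>{}\<^esub>\<close>.\<close>

definition ext_family :: "nat \<Rightarrow> (nat \<Rightarrow> nat \<Rightarrow> real) \<Rightarrow> nat set \<Rightarrow> ext_elem" where
  "ext_family n f \<sigma> =
    foldr wedge (map (\<lambda>i. ext_vector n (f i)) (sorted_list_of_set \<sigma>)) (ext_basis {})"

text \<open>Linear independence of \<open>f\<^sub>1, \<dots>, f\<^sub>n\<close> follows from the algebraic independence, as the
  determinant is a nonzero integer polynomial in the coordinates of \<open>f\<^sub>2, \<dots>, f\<^sub>n\<close>.\<close>

definition generic_basis :: "nat \<Rightarrow> (nat \<Rightarrow> nat \<Rightarrow> real) \<Rightarrow> bool" where
  "generic_basis n f \<longleftrightarrow>
    (\<forall>j\<in>{1..n}. f 1 j = 1) \<and> alg_indep_family ({2..n} \<times> {1..n}) (\<lambda>(i, j). f i j)"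


section \<open>Shifting\<close>

definition nonface_ideal :: "nat \<Rightarrow> nat set set \<Rightarrow> ext_elem set" where
  "nonface_ideal n K = ext.span {wedge (wedge x (ext_basis S)) y | x S y.
     x \<in> ext_carrier n \<and> y \<in> ext_carrier n \<and> S \<subseteq> {1..n} \<and> S \<notin> K}"

text \<open>The quotient map sends an element to its coset.\<close>

definition face_quotient :: "nat \<Rightarrow> nat set set \<Rightarrow> ext_elem \<Rightarrow> ext_elem set" where
  "face_quotient n K x = {x + y | y. y \<in> nonface_ideal n K}"

definition le_p :: "nat set \<Rightarrow> nat set \<Rightarrow> bool" where
  "le_p \<sigma> \<tau> \<longleftrightarrow> list_all2 (\<le>) (sorted_list_of_set \<sigma>) (sorted_list_of_set \<tau>)"

definition less_p :: "nat set \<Rightarrow> nat set \<Rightarrow> bool" where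
  "less_p \<sigma> \<tau> \<longleftrightarrow> le_p \<sigma> \<tau> \<and> \<sigma> \<noteq> \<tau>"

text \<open>The linear structure of the quotient is the one that makes the quotient map \<open>q\<close> linear, so the
  span of the \<open>q(f\<^sub>\<tau>)\<close> is the image under \<open>q\<close> of the span of the \<open>f\<^sub>\<tau>\<close>.\<close>

definition partial_shift :: "nat \<Rightarrow> (nat \<Rightarrow> nat \<Rightarrow> real) \<Rightarrow> nat set set \<Rightarrow> nat set set" where
  "partial_shift n f K = {\<sigma>. \<sigma> \<subseteq> {1..n} \<and>
     face_quotient n K (ext_family n f \<sigma>) \<notin>
       face_quotient n K ` ext.span {ext_family n f \<tau> | \<tau>.
         \<tau> \<subseteq> {1..n} \<and> less_p \<tau> \<sigma> \<and> card \<tau> = card \<sigma>}}"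

end

theory Submission
  imports Defs
begin

text \<open>Write \<open>\<sigma> = {1, 3, \<dots>, d, n}\<close>, and let \<open>\<Phi> \<tau>\<close> be the part of \<open>f\<^sub>\<tau>\<close> supported on the faces of \<open>K\<close>,
  that is, the class of \<open>f\<^sub>\<tau>\<close> in the quotient \<open>\<Lambda>K\<close>. Suppose first that \<open>d < n\<close>. The sets below \<open>\<sigma>\<close> in
  the partial order, \<open>\<sigma>\<close> included, are \<open>[d]\<close> and the sets \<open>[d] - {j} \<union> {k}\<close> with \<open>2 \<le> j \<le> d < k \<le> n\<close>
  (\<open>le_p_iff_exchange\<close>). They form the exchange family \<open>S\<close>, whose size \<open>1 + (d - 1)(n - d)\<close> is the
  rank that volume rigidity asks for (\<open>card_exchange_family\<close>).

  Both sides of the equivalence are statements about the vectors \<open>\<Phi> \<tau>\<close>, \<open>\<tau> \<in> S\<close>. For the rigidity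
  side, use \<open>f\<^sub>2, \<dots>, f\<^sub>d\<close> as the coordinate functions of the vertex positions. By Laplace expansion, a
  coefficient of a wedge product of vectors is a minor (\<open>wedge_list_eq_det\<close>), so the row of the rigidity
  matrix for the coordinate \<open>j\<close> of the vertex \<open>v\<close> is, up to sign, the \<open>K\<close>-part of \<open>e\<^sub>v \<and> P\<^sub>j\<close>, where \<open>P\<^sub>j\<close>
  is the wedge product of the \<open>f\<^sub>i\<close>, \<open>i \<le> d\<close>, except the one that gives the coordinate \<open>j\<close>. Expanding the
  \<open>e\<^sub>v\<close> in the basis \<open>f\<^sub>1, \<dots>, f\<^sub>n\<close> and conversely, one sees that the row space is spanned by the \<open>\<Phi> \<tau>\<close>
  (\<open>span_rigidity_rows\<close>). As row rank equals column rank (\<open>rank_eq_dim_rows\<close>), \<open>K\<close> is volume-rigid iff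
  the \<open>\<Phi> \<tau>\<close> are linearly independent (\<open>volume_rigid_iff_independent\<close>).

  The shifting side says only that \<open>\<Phi> \<sigma>\<close> is not in the span of the other \<open>\<Phi> \<tau>\<close>. Symmetry closes the
  gap. A permutation of \<open>f\<^sub>2, \<dots>, f\<^sub>d\<close> together with a permutation of \<open>f\<^bsub>d+1\<^esub>, \<dots>, f\<^sub>n\<close> yields another generic
  basis, permutes \<open>S\<close> up to signs, and can carry \<open>\<sigma>\<close> to any \<open>\<rho> \<in> S\<close> other than \<open>[d]\<close>. Membership in a
  span does not depend on the choice of the generic point (\<open>span_membership_transfer\<close>), hence no such
  \<open>\<Phi> \<rho>\<close> lies in the span of the others (\<open>shift_membership_symmetric\<close>). So a nontrivial relation could
  only involve \<open>\<Phi> [d]\<close>, and \<open>\<Phi> [d] \<noteq> 0\<close> because a generic minor does not vanish.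

  Transfer between generic points rests on elimination: a linear relation between vectors with
  polynomial entries that holds at one generic point can be replaced by a relation with polynomial
  coefficients (\<open>polynomial_relation_lift\<close>), and this relation is an identity of polynomials because its
  entries vanish at the generic point.

  If \<open>n = d\<close>, then \<open>\<sigma>\<close> has only \<open>d - 1\<close> elements and \<open>K\<close> is a simplex. Both sides are then true: the
  single facet gives rank one, and a wedge product with \<open>f\<^sub>2\<close> kills every \<open>f\<^sub>\<tau>\<close> below \<open>f\<^sub>\<sigma>\<close> but not \<open>f\<^sub>\<sigma>\<close>
  (\<open>shift_of_simplex\<close>).\<close>


section \<open>Rational polynomial functions and algebraically independent points\<close>

definition monomial_value :: "('i \<Rightarrow> real) \<Rightarrow> ('i \<Rightarrow>\<^sub>0 nat) \<Rightarrow> real" where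
  "monomial_value x m = (\<Prod>i\<in>Poly_Mapping.keys m. x i ^ Poly_Mapping.lookup m i)"

lemma monomial_value_superset:
  assumes "finite A" "Poly_Mapping.keys m \<subseteq> A"
  shows "monomial_value x m = (\<Prod>i\<in>A. x i ^ Poly_Mapping.lookup m i)"
  unfolding monomial_value_def
  by (rule prod.mono_neutral_left) (use assms in \<open>auto simp: in_keys_iff\<close>)

lemma monomial_value_add:
  "monomial_value x (m + m') = monomial_value x m * monomial_value x m'"
proof -
  let ?A = "Poly_Mapping.keys m \<union> Poly_Mapping.keys m'"
  have "monomial_value x (m + m') = (\<Prod>i\<in>?A. x i ^ Poly_Mapping.lookup (m + m') i)"
    by (rule monomial_value_superset) (use Poly_Mapping.keys_add[of m m'] in auto)
  also have "\<dots> = (\<Prod>i\<in>?A. x i ^ Poly_Mapping.lookup m i) * (\<Prod>i\<in>?A. x i ^ Poly_Mapping.lookup m' i)"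
    by (simp add: lookup_add power_add prod.distrib)
  also have "\<dots> = monomial_value x m * monomial_value x m'"
    by (simp add: monomial_value_superset[of ?A])
  finally show ?thesis .
qed

lemma rat_poly_eval_superset:
  assumes "finite M" "Poly_Mapping.keys P \<subseteq> M"
  shows "rat_poly_eval x P = (\<Sum>m\<in>M. of_rat (Poly_Mapping.lookup P m) * monomial_value x m)"
  unfolding rat_poly_eval_def monomial_value_def[symmetric]
  by (rule sum.mono_neutral_left) (use assms in \<open>auto simp: in_keys_iff\<close>)

lemma rat_poly_eval_zero [simp]: "rat_poly_eval x 0 = 0"
  by (simp add: rat_poly_eval_def)

lemma rat_poly_eval_single [simp]:
  "rat_poly_eval x (Poly_Mapping.single m c) = of_rat c * monomial_value x m"
  by (subst rat_poly_eval_superset[of "{m}"]) (auto simp: lookup_single)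

lemma rat_poly_eval_add:
  "rat_poly_eval x (P + Q) = rat_poly_eval x P + rat_poly_eval x Q"
proof -
  let ?M = "Poly_Mapping.keys P \<union> Poly_Mapping.keys Q"
  have "rat_poly_eval x (P + Q)
      = (\<Sum>m\<in>?M. of_rat (Poly_Mapping.lookup (P + Q) m) * monomial_value x m)"
    by (rule rat_poly_eval_superset) (use Poly_Mapping.keys_add[of P Q] in auto)
  also have "\<dots> = rat_poly_eval x P + rat_poly_eval x Q"
    by (simp add: rat_poly_eval_superset[of ?M] lookup_add of_rat_add distrib_right sum.distrib)
  finally show ?thesis .
qed

lemma rat_poly_eval_sum:
  "rat_poly_eval x (\<Sum>a\<in>A. P a) = (\<Sum>a\<in>A. rat_poly_eval x (P a))"
  by (induction A rule: infinite_finite_induct) (auto simp: rat_poly_eval_add)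

lemma poly_mapping_sum_single:
  "P = (\<Sum>m\<in>Poly_Mapping.keys P. Poly_Mapping.single m (Poly_Mapping.lookup P m))"
  by (rule poly_mapping_eqI)
     (simp add: lookup_sum lookup_single when_def in_keys_iff)

lemma rat_poly_eval_mult:
  "rat_poly_eval x (P * Q) = rat_poly_eval x P * rat_poly_eval x Q"
proof -
  have "P * Q = (\<Sum>m\<in>Poly_Mapping.keys P. Poly_Mapping.single m (Poly_Mapping.lookup P m))
              * (\<Sum>m\<in>Poly_Mapping.keys Q. Poly_Mapping.single m (Poly_Mapping.lookup Q m))"
    using poly_mapping_sum_single[of P] poly_mapping_sum_single[of Q] by simp
  then have "rat_poly_eval x (P * Q) =
     (\<Sum>m\<in>Poly_Mapping.keys P. \<Sum>m'\<in>Poly_Mapping.keys Q.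
        (of_rat (Poly_Mapping.lookup P m) * monomial_value x m) *
        (of_rat (Poly_Mapping.lookup Q m') * monomial_value x m'))"
    by (simp add: sum_product mult_single rat_poly_eval_sum of_rat_mult monomial_value_add mult_ac)
  then show ?thesis
    by (simp add: sum_product rat_poly_eval_def monomial_value_def)
qed

text \<open>A predicate on functions: entries of vectors can then be written as ordinary expressions in the
  coordinates, and their polynomiality follows from closure rules.\<close>

definition rat_polyfun :: "'i set \<Rightarrow> (('i \<Rightarrow> real) \<Rightarrow> real) \<Rightarrow> bool" where
  "rat_polyfun I g \<longleftrightarrow>
    (\<exists>P. (\<forall>m\<in>Poly_Mapping.keys P. Poly_Mapping.keys m \<subseteq> I) \<and> g = (\<lambda>x. rat_poly_eval x P))"

lemma rat_polyfun_const: "rat_polyfun I (\<lambda>_. of_rat c)"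
  unfolding rat_polyfun_def
  by (rule exI[of _ "Poly_Mapping.single 0 c"]) (auto simp: monomial_value_def)

lemma rat_polyfun_0: "rat_polyfun I (\<lambda>_. 0)" and rat_polyfun_1: "rat_polyfun I (\<lambda>_. 1)"
  using rat_polyfun_const[of I 0] rat_polyfun_const[of I 1] by simp_all

lemma rat_polyfun_var: "i \<in> I \<Longrightarrow> rat_polyfun I (\<lambda>x. x i)"
  unfolding rat_polyfun_def
  by (rule exI[of _ "Poly_Mapping.single (Poly_Mapping.single i 1) 1"])
     (auto simp: monomial_value_def)

lemma rat_polyfun_add:
  assumes "rat_polyfun I g" "rat_polyfun I h"
  shows "rat_polyfun I (\<lambda>x. g x + h x)"
proof -
  obtain P Q where PQ: "\<forall>m\<in>Poly_Mapping.keys P. Poly_Mapping.keys m \<subseteq> I" "g = (\<lambda>x. rat_poly_eval x P)"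
      "\<forall>m\<in>Poly_Mapping.keys Q. Poly_Mapping.keys m \<subseteq> I" "h = (\<lambda>x. rat_poly_eval x Q)"
    using assms unfolding rat_polyfun_def by blast
  have "\<forall>m\<in>Poly_Mapping.keys (P + Q). Poly_Mapping.keys m \<subseteq> I"
    using PQ(1,3) Poly_Mapping.keys_add[of P Q] by blast
  then show ?thesis
    unfolding rat_polyfun_def PQ(2,4) by (intro exI[of _ "P + Q"]) (simp add: rat_poly_eval_add)
qed

lemma rat_polyfun_mult:
  assumes "rat_polyfun I g" "rat_polyfun I h"
  shows "rat_polyfun I (\<lambda>x. g x * h x)"
proof -
  obtain P Q where PQ: "\<forall>m\<in>Poly_Mapping.keys P. Poly_Mapping.keys m \<subseteq> I" "g = (\<lambda>x. rat_poly_eval x P)"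
      "\<forall>m\<in>Poly_Mapping.keys Q. Poly_Mapping.keys m \<subseteq> I" "h = (\<lambda>x. rat_poly_eval x Q)"
    using assms unfolding rat_polyfun_def by blast
  have "Poly_Mapping.keys m \<subseteq> I" if m: "m \<in> Poly_Mapping.keys (P * Q)" for m
  proof -
    obtain a b where "m = a + b" "a \<in> Poly_Mapping.keys P" "b \<in> Poly_Mapping.keys Q"
      using m Poly_Mapping.keys_mult[of P Q] by blast
    then show ?thesis using PQ(1,3) Poly_Mapping.keys_add[of a b] by blast
  qed
  then show ?thesis
    unfolding rat_polyfun_def PQ(2,4) by (intro exI[of _ "P * Q"]) (simp add: rat_poly_eval_mult)
qed

lemma rat_polyfun_uminus: "rat_polyfun I g \<Longrightarrow> rat_polyfun I (\<lambda>x. - g x)"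
  using rat_polyfun_mult[OF rat_polyfun_const[of I "-1"], of g] by simp

lemma rat_polyfun_diff:
  "rat_polyfun I g \<Longrightarrow> rat_polyfun I h \<Longrightarrow> rat_polyfun I (\<lambda>x. g x - h x)"
  using rat_polyfun_add[of I g "\<lambda>x. - h x"] rat_polyfun_uminus[of I h] by simp

lemma rat_polyfun_sum:
  "(\<And>a. a \<in> A \<Longrightarrow> rat_polyfun I (g a)) \<Longrightarrow> rat_polyfun I (\<lambda>x. \<Sum>a\<in>A. g a x)"
  by (induction A rule: infinite_finite_induct) (auto simp: rat_polyfun_0 rat_polyfun_add)

lemma rat_polyfun_sign: "rat_polyfun I (\<lambda>_. (-1) ^ k)"
  using rat_polyfun_const[of I "(-1) ^ k"] by (simp add: of_rat_power)

lemmas rat_polyfun_intros = rat_polyfun_0 rat_polyfun_1 rat_polyfun_var rat_polyfun_add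
  rat_polyfun_mult rat_polyfun_uminus rat_polyfun_diff rat_polyfun_sum rat_polyfun_sign

text \<open>A generic point is a zero test: a rational polynomial function that vanishes there comes from the
  zero polynomial. Every later argument from genericity is an application of this test.\<close>

lemma rat_polyfun_zero_if_zero_at_generic:
  assumes "alg_indep_family I x" "rat_polyfun I g" "g x = 0"
  shows "g y = 0"
proof -
  obtain P where P: "\<forall>m\<in>Poly_Mapping.keys P. Poly_Mapping.keys m \<subseteq> I" "g = (\<lambda>x. rat_poly_eval x P)"
    using assms(2) unfolding rat_polyfun_def by blast
  then have "P = 0"
    using assms(1,3) unfolding alg_indep_family_def by blast
  then show ?thesis by (simp add: P)
qed

lemma alg_indep_family_cong:
  assumes "alg_indep_family I x" "\<And>i. i \<in> I \<Longrightarrow> x i = y i"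
  shows "alg_indep_family I y"
  unfolding alg_indep_family_def
proof (intro allI impI, elim conjE)
  fix P :: "('a \<Rightarrow>\<^sub>0 nat) \<Rightarrow>\<^sub>0 rat"
  assume P: "\<forall>m\<in>Poly_Mapping.keys P. Poly_Mapping.keys m \<subseteq> I" "rat_poly_eval y P = 0"
  have "rat_poly_eval x P = rat_poly_eval y P"
    unfolding rat_poly_eval_def
  proof (rule sum.cong[OF refl])
    fix m assume "m \<in> Poly_Mapping.keys P"
    then have "x i = y i" if "i \<in> Poly_Mapping.keys m" for i
      using P(1) assms(2) that by blast
    then have "(\<Prod>i\<in>Poly_Mapping.keys m. x i ^ Poly_Mapping.lookup m i)
        = (\<Prod>i\<in>Poly_Mapping.keys m. y i ^ Poly_Mapping.lookup m i)"
      by (intro prod.cong) auto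
    then show "of_rat (Poly_Mapping.lookup P m) * (\<Prod>i\<in>Poly_Mapping.keys m. x i ^ Poly_Mapping.lookup m i)
        = of_rat (Poly_Mapping.lookup P m) * (\<Prod>i\<in>Poly_Mapping.keys m. y i ^ Poly_Mapping.lookup m i)"
      by simp
  qed
  then show "P = 0" using P assms(1) unfolding alg_indep_family_def by metis
qed

text \<open>Renaming the variables of a polynomial along \<open>h\<close> sends distinct monomials to distinct monomials, so a
  polynomial relation for the subfamily becomes one for the whole family without any cancellation.\<close>

lemma alg_indep_family_reindex:
  fixes h :: "'j \<Rightarrow> 'i"
  assumes "alg_indep_family I x" "inj_on h J" "h ` J \<subseteq> I"
  shows "alg_indep_family J (\<lambda>j. x (h j))"
  unfolding alg_indep_family_def
proof (intro allI impI, elim conjE)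
  fix P :: "('j \<Rightarrow>\<^sub>0 nat) \<Rightarrow>\<^sub>0 rat"
  assume PJ: "\<forall>m\<in>Poly_Mapping.keys P. Poly_Mapping.keys m \<subseteq> J"
    and P0: "rat_poly_eval (\<lambda>j. x (h j)) P = 0"
  define push where "push m =
    (\<Sum>j\<in>Poly_Mapping.keys m. Poly_Mapping.single (h j) (Poly_Mapping.lookup m j))"
    for m :: "'j \<Rightarrow>\<^sub>0 nat"
  define Q where "Q = (\<Sum>m\<in>Poly_Mapping.keys P. Poly_Mapping.single (push m) (Poly_Mapping.lookup P m))"
  have push_lookup: "Poly_Mapping.lookup (push m) (h j) = Poly_Mapping.lookup m j"
    if "Poly_Mapping.keys m \<subseteq> J" "j \<in> J" for m j
  proof -
    have "Poly_Mapping.lookup (push m) (h j)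
        = (\<Sum>l\<in>Poly_Mapping.keys m. if l = j then Poly_Mapping.lookup m l else 0)"
      unfolding push_def lookup_sum lookup_single when_def
      by (rule sum.cong) (use that assms(2) in \<open>auto simp: inj_on_def\<close>)
    then show ?thesis by (simp add: in_keys_iff)
  qed
  have push_keys: "Poly_Mapping.keys (push m) = h ` Poly_Mapping.keys m"
    if "Poly_Mapping.keys m \<subseteq> J" for m
  proof
    show "Poly_Mapping.keys (push m) \<subseteq> h ` Poly_Mapping.keys m"
      unfolding push_def using Poly_Mapping.keys_sum by (force split: if_splits)
    show "h ` Poly_Mapping.keys m \<subseteq> Poly_Mapping.keys (push m)"
      using that push_lookup[OF that] by (auto simp: in_keys_iff)
  qed
  have push_inj: "inj_on push (Poly_Mapping.keys P)"
  proof (rule inj_onI)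
    fix m m' assume m: "m \<in> Poly_Mapping.keys P" "m' \<in> Poly_Mapping.keys P" "push m = push m'"
    show "m = m'"
    proof (rule poly_mapping_eqI)
      fix j show "Poly_Mapping.lookup m j = Poly_Mapping.lookup m' j"
      proof (cases "j \<in> J")
        case True
        then show ?thesis using m PJ push_lookup by metis
      next
        case False
        then show ?thesis using m PJ by (metis in_keys_iff subsetD)
      qed
    qed
  qed
  have push_value: "monomial_value x (push m) = monomial_value (\<lambda>j. x (h j)) m"
    if "Poly_Mapping.keys m \<subseteq> J" for m
    unfolding monomial_value_def push_keys[OF that]
    by (subst prod.reindex) (use that push_lookup[OF that] inj_on_subset[OF assms(2)] in \<open>auto intro!: prod.cong\<close>)
  have "rat_poly_eval x Q = rat_poly_eval (\<lambda>j. x (h j)) P"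
    unfolding Q_def rat_poly_eval_sum
    by (simp add: rat_poly_eval_def[of _ P] monomial_value_def[symmetric] PJ push_value)
  then have "rat_poly_eval x Q = 0" using P0 by simp
  moreover have "\<forall>m\<in>Poly_Mapping.keys Q. Poly_Mapping.keys m \<subseteq> I"
  proof
    fix m assume "m \<in> Poly_Mapping.keys Q"
    then obtain l where "l \<in> Poly_Mapping.keys P" "m = push l"
      unfolding Q_def using Poly_Mapping.keys_sum by (fastforce split: if_splits)
    then show "Poly_Mapping.keys m \<subseteq> I" using push_keys PJ assms(3) by blast
  qed
  ultimately have Q0: "Q = 0"
    using assms(1) unfolding alg_indep_family_def by blast
  have "Poly_Mapping.lookup Q (push m) = Poly_Mapping.lookup P m" if "m \<in> Poly_Mapping.keys P" for m
  proof -
    have "Poly_Mapping.lookup Q (push m)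
        = (\<Sum>l\<in>Poly_Mapping.keys P. if l = m then Poly_Mapping.lookup P l else 0)"
      unfolding Q_def lookup_sum lookup_single when_def
      by (rule sum.cong) (use that push_inj in \<open>auto simp: inj_on_def\<close>)
    then show ?thesis using that by simp
  qed
  then show "P = 0"
    by (metis Q0 lookup_zero in_keys_iff poly_mapping_eqI)
qed


section \<open>Linear relations at generic points\<close>

text \<open>Gaussian elimination over the ring of polynomial functions. Each coordinate \<open>c0\<close> is removed either
  by a pivot vector \<open>t0\<close> whose entry is nonzero at the generic point, or because all its entries vanish
  identically. The distinguished vector \<open>t1\<close> keeps a nonzero coefficient, since the pivot can always be
  chosen different from \<open>t1\<close>: if only \<open>t1\<close> had a nonzero entry at \<open>c0\<close>, the given relation would force
  \<open>u t1 = 0\<close>.\<close>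

lemma polynomial_relation_lift:
  fixes V :: "'t \<Rightarrow> 'c \<Rightarrow> ('i \<Rightarrow> real) \<Rightarrow> real"
  assumes x: "alg_indep_family I x"
    and "finite C" "finite T" "\<And>t c. t \<in> T \<Longrightarrow> c \<in> C \<Longrightarrow> rat_polyfun I (V t c)"
    and "t1 \<in> T" "u t1 \<noteq> 0" "\<And>c. c \<in> C \<Longrightarrow> (\<Sum>t\<in>T. u t * V t c x) = 0"
  shows "\<exists>U. (\<forall>t\<in>T. rat_polyfun I (U t)) \<and> U t1 x \<noteq> 0 \<and>
    (\<forall>c\<in>C. \<forall>y. (\<Sum>t\<in>T. U t y * V t c y) = 0)"
  using assms(2-)
proof (induction C arbitrary: T V rule: finite_induct)
  case empty
  then show ?case by (intro exI[of _ "\<lambda>_ _. 1"]) (auto simp: rat_polyfun_1)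
next
  case (insert c0 C T V)
  have polyV: "\<And>t c. t \<in> T \<Longrightarrow> c \<in> insert c0 C \<Longrightarrow> rat_polyfun I (V t c)" by fact
  show ?case
  proof (cases "\<exists>t\<in>T - {t1}. V t c0 x \<noteq> 0")
    case True
    then obtain t0 where t0: "t0 \<in> T" "t0 \<noteq> t1" "V t0 c0 x \<noteq> 0" by blast
    \<comment> \<open>Eliminate \<open>c0\<close> without division, by cross-multiplication with the pivot row.\<close>
    define V' where "V' t c y = V t0 c0 y * V t c y - V t c0 y * V t0 c y" for t c y
    have split: "(\<Sum>t\<in>T. g t) = g t0 + (\<Sum>t\<in>T - {t0}. g t)" for g :: "'t \<Rightarrow> real"
      using t0 insert.prems(1) by (simp add: sum.remove)
    have rel': "(\<Sum>t\<in>T - {t0}. u t * V' t c x) = 0" if "c \<in> C" for c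
    proof -
      have 1: "(\<Sum>t\<in>T - {t0}. u t * V t c x) = - u t0 * V t0 c x"
        and 2: "(\<Sum>t\<in>T - {t0}. u t * V t c0 x) = - u t0 * V t0 c0 x"
        using insert.prems(5)[of c] insert.prems(5)[of c0] that split[of "\<lambda>t. u t * V t c x"]
          split[of "\<lambda>t. u t * V t c0 x"] by auto
      have "(\<Sum>t\<in>T - {t0}. u t * V' t c x)
          = V t0 c0 x * (\<Sum>t\<in>T - {t0}. u t * V t c x) - V t0 c x * (\<Sum>t\<in>T - {t0}. u t * V t c0 x)"
        by (simp add: V'_def sum_distrib_left sum_subtractf algebra_simps)
      then show ?thesis unfolding 1 2 by simp
    qed
    have polyV': "rat_polyfun I (V' t c)" if "t \<in> T - {t0}" "c \<in> C" for t c
      unfolding V'_def using that t0 by (intro rat_polyfun_intros polyV) auto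
    have "\<exists>U. (\<forall>t\<in>T - {t0}. rat_polyfun I (U t)) \<and> U t1 x \<noteq> 0 \<and>
        (\<forall>c\<in>C. \<forall>y. (\<Sum>t\<in>T - {t0}. U t y * V' t c y) = 0)"
      by (rule insert.IH) (use insert.prems t0 rel' polyV' in auto)
    then obtain U where U: "\<forall>t\<in>T - {t0}. rat_polyfun I (U t)" "U t1 x \<noteq> 0"
        "\<forall>c\<in>C. \<forall>y. (\<Sum>t\<in>T - {t0}. U t y * V' t c y) = 0" by blast
    \<comment> \<open>Undo the elimination; the pivot coefficient is the one that makes the coordinate \<open>c0\<close> vanish.\<close>
    define W where "W t = (if t = t0 then (\<lambda>y. - (\<Sum>t\<in>T - {t0}. U t y * V t c0 y))
      else (\<lambda>y. V t0 c0 y * U t y))" for t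
    have WW: "(\<Sum>t\<in>T. W t y * V t c y) = (\<Sum>t\<in>T - {t0}. U t y * V' t c y)" for c y
    proof -
      have "(\<Sum>t\<in>T - {t0}. W t y * V t c y) = (\<Sum>t\<in>T - {t0}. V t0 c0 y * U t y * V t c y)"
        by (rule sum.cong) (auto simp: W_def)
      then show ?thesis
        by (simp add: split W_def V'_def sum_distrib_left sum_subtractf algebra_simps)
    qed
    have "rat_polyfun I (W t)" if "t \<in> T" for t
    proof (cases "t = t0")
      case True
      then show ?thesis using U(1)
        by (auto simp: W_def intro!: rat_polyfun_intros polyV)
    next
      case False
      then show ?thesis using U(1) that t0
        by (auto simp: W_def intro!: rat_polyfun_intros polyV)
    qed
    moreover have "W t1 x \<noteq> 0" using t0 U(2) by (auto simp: W_def)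
    moreover have "(\<Sum>t\<in>T. W t y * V t c y) = 0" if "c \<in> insert c0 C" for c y
    proof (cases "c = c0")
      case True
      then show ?thesis unfolding WW by (simp add: V'_def)
    next
      case False
      then show ?thesis using that U(3) unfolding WW by simp
    qed
    ultimately show ?thesis by blast
  next
    case False
    then have "(\<Sum>t\<in>T. u t * V t c0 x) = u t1 * V t1 c0 x"
      using insert.prems(1,3) by (simp add: sum.remove[of T t1])
    then have "V t1 c0 x = 0" using insert.prems(4,5) by auto
    then have Vc0: "V t c0 y = 0" if "t \<in> T" for t y
      using that False rat_polyfun_zero_if_zero_at_generic[OF x polyV[of t c0]] by auto
    have "\<exists>U. (\<forall>t\<in>T. rat_polyfun I (U t)) \<and> U t1 x \<noteq> 0 \<and>
        (\<forall>c\<in>C. \<forall>y. (\<Sum>t\<in>T. U t y * V t c y) = 0)"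
      by (rule insert.IH) (use insert.prems in auto)
    then show ?thesis using Vc0 by auto
  qed
qed

lemma ext_scale_apply: "ext_scale c v S = c * v S"
  by (simp add: ext_scale_def)

lemma sum_ext_apply: "(\<Sum>a\<in>A. (v a :: ext_elem)) S = (\<Sum>a\<in>A. v a S)"
  by (induction A rule: infinite_finite_induct) auto

lemma ext_span_image_iff:
  assumes "finite T"
  shows "z \<in> ext.span (\<phi> ` T) \<longleftrightarrow> (\<exists>u. z = (\<Sum>t\<in>T. ext_scale (u t) (\<phi> t)))"
proof
  show "\<exists>u. z = (\<Sum>t\<in>T. ext_scale (u t) (\<phi> t))" if "z \<in> ext.span (\<phi> ` T)"
    using that
  proof (induction rule: ext.span_induct_alt)
    case base
    show ?case by (rule exI[of _ "\<lambda>_. 0"]) (simp add: ext.scale_zero_left)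
  next
    case (step c a y)
    then obtain t u where t: "t \<in> T" "a = \<phi> t" and u: "y = (\<Sum>t\<in>T. ext_scale (u t) (\<phi> t))" by blast
    have "ext_scale c a + y = (\<Sum>s\<in>T. ext_scale (if s = t then c + u s else u s) (\<phi> s))"
      unfolding u t using t(1) assms
      by (simp add: sum.remove[of T t] ext.scale_left_distrib add.assoc)
    then show ?case by (intro exI[of _ "\<lambda>s. if s = t then c + u s else u s"])
  qed
  show "z \<in> ext.span (\<phi> ` T)" if "\<exists>u. z = (\<Sum>t\<in>T. ext_scale (u t) (\<phi> t))"
    using that by (elim exE) (simp, intro ext.span_sum ext.span_scale ext.span_base imageI)
qed

lemma span_image_scale:
  assumes "\<And>t. t \<in> T \<Longrightarrow> c t \<noteq> 0"
  shows "ext.span ((\<lambda>t. ext_scale (c t) (\<phi> t)) ` T) = ext.span (\<phi> ` T)"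
proof (rule antisym)
  show "ext.span ((\<lambda>t. ext_scale (c t) (\<phi> t)) ` T) \<subseteq> ext.span (\<phi> ` T)"
    by (rule ext.span_minimal) (auto intro: ext.span_scale ext.span_base)
  have "\<phi> t \<in> ext.span ((\<lambda>t. ext_scale (c t) (\<phi> t)) ` T)" if "t \<in> T" for t
  proof -
    have "\<phi> t = ext_scale (1 / c t) (ext_scale (c t) (\<phi> t))"
      using assms[OF that] by (simp add: ext_scale_def fun_eq_iff)
    also have "\<dots> \<in> ext.span ((\<lambda>t. ext_scale (c t) (\<phi> t)) ` T)"
      using that by (intro ext.span_scale ext.span_base) auto
    finally show ?thesis .
  qed
  then show "ext.span (\<phi> ` T) \<subseteq> ext.span ((\<lambda>t. ext_scale (c t) (\<phi> t)) ` T)"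
    by (intro ext.span_minimal) auto
qed

text \<open>Lift the relation that expresses \<open>\<phi> t1\<close> at \<open>x\<close> to one with polynomial coefficients. It holds at \<open>y\<close>
  as well, and the coefficient of \<open>\<phi> t1\<close> does not vanish at \<open>y\<close>, because \<open>y\<close> is generic too.\<close>

lemma span_membership_transfer:
  fixes \<phi> :: "'t \<Rightarrow> ('i \<Rightarrow> real) \<Rightarrow> ext_elem"
  assumes "alg_indep_family I x" "alg_indep_family I y" "finite T"
    and finC: "finite C" and supp: "\<And>t z S. t \<in> insert t1 T \<Longrightarrow> S \<notin> C \<Longrightarrow> \<phi> t z S = 0"
    and poly: "\<And>t S. t \<in> insert t1 T \<Longrightarrow> rat_polyfun I (\<lambda>z. \<phi> t z S)"
    and mem: "\<phi> t1 x \<in> ext.span ((\<lambda>t. \<phi> t x) ` T)"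
  shows "\<phi> t1 y \<in> ext.span ((\<lambda>t. \<phi> t y) ` T)"
proof (cases "t1 \<in> T")
  case True
  then show ?thesis by (intro ext.span_base) auto
next
  case t1: False
  obtain u where u: "\<phi> t1 x = (\<Sum>t\<in>T. ext_scale (u t) (\<phi> t x))"
    using mem unfolding ext_span_image_iff[OF \<open>finite T\<close>] by blast
  define u' where "u' t = (if t = t1 then -1 else u t)" for t
  have "(\<Sum>t\<in>insert t1 T. u' t * \<phi> t x S) = 0" for S
  proof -
    have "\<phi> t1 x S = (\<Sum>t\<in>T. u t * \<phi> t x S)"
      by (simp add: u sum_ext_apply ext_scale_apply)
    moreover have "(\<Sum>t\<in>T. u' t * \<phi> t x S) = (\<Sum>t\<in>T. u t * \<phi> t x S)"
      by (rule sum.cong) (use t1 in \<open>auto simp: u'_def\<close>)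
    ultimately show ?thesis using t1 \<open>finite T\<close> by (simp add: u'_def)
  qed
  then have "\<exists>U. (\<forall>t\<in>insert t1 T. rat_polyfun I (U t)) \<and> U t1 x \<noteq> 0 \<and>
    (\<forall>S\<in>C. \<forall>y. (\<Sum>t\<in>insert t1 T. U t y * \<phi> t y S) = 0)"
    using assms by (intro polynomial_relation_lift[where u = u']) (auto simp: u'_def)
  then obtain U where U: "rat_polyfun I (U t1)" "U t1 x \<noteq> 0"
      "\<And>S y. S \<in> C \<Longrightarrow> (\<Sum>t\<in>insert t1 T. U t y * \<phi> t y S) = 0" by auto
  have Uy: "U t1 y \<noteq> 0"
    using rat_polyfun_zero_if_zero_at_generic[OF assms(2) U(1)] U(2) by blast
  have "\<phi> t1 y S = (\<Sum>t\<in>T. - U t y / U t1 y * \<phi> t y S)" for S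
  proof (cases "S \<in> C")
    case True
    have "U t1 y * \<phi> t1 y S + (\<Sum>t\<in>T. U t y * \<phi> t y S) = 0"
      using U(3)[OF True] t1 \<open>finite T\<close> by simp
    then have "\<phi> t1 y S = - (\<Sum>t\<in>T. U t y * \<phi> t y S) / U t1 y"
      using Uy by (simp add: field_simps)
    then show ?thesis by (simp add: sum_divide_distrib sum_negf)
  next
    case False
    then show ?thesis using supp by simp
  qed
  then have "\<phi> t1 y = (\<Sum>t\<in>T. ext_scale (- U t y / U t1 y) (\<phi> t y))"
    by (simp add: fun_eq_iff sum_ext_apply ext_scale_apply)
  then show ?thesis unfolding ext_span_image_iff[OF \<open>finite T\<close>]
    by (intro exI[of _ "\<lambda>t. - U t y / U t1 y"])
qed

text \<open>A subfamily that is a basis at \<open>x\<close> still spans at \<open>y\<close>. With the roles of \<open>x\<close> and \<open>y\<close> exchanged, the two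
  dimensions agree.\<close>

lemma dim_generic_family_le:
  fixes \<phi> :: "'t \<Rightarrow> ('i \<Rightarrow> real) \<Rightarrow> ext_elem"
  assumes "alg_indep_family I x" "alg_indep_family I y" "finite T" "finite C"
    and supp: "\<And>t z S. t \<in> T \<Longrightarrow> S \<notin> C \<Longrightarrow> \<phi> t z S = 0"
    and poly: "\<And>t S. t \<in> T \<Longrightarrow> rat_polyfun I (\<lambda>z. \<phi> t z S)"
  shows "ext.dim ((\<lambda>t. \<phi> t y) ` T) \<le> ext.dim ((\<lambda>t. \<phi> t x) ` T)"
proof -
  obtain B where B: "B \<subseteq> (\<lambda>t. \<phi> t x) ` T" "(\<lambda>t. \<phi> t x) ` T \<subseteq> ext.span B"
      "card B = ext.dim ((\<lambda>t. \<phi> t x) ` T)"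
    using ext.basis_exists by metis
  obtain T0 where T0: "T0 \<subseteq> T" "inj_on (\<lambda>t. \<phi> t x) T0" "B = (\<lambda>t. \<phi> t x) ` T0"
    using B(1) subset_image_inj by metis
  have "finite T0" using T0(1) \<open>finite T\<close> finite_subset by blast
  have "\<phi> t y \<in> ext.span ((\<lambda>t. \<phi> t y) ` T0)" if "t \<in> T" for t
    by (rule span_membership_transfer[OF assms(1,2) \<open>finite T0\<close> \<open>finite C\<close>])
       (use that T0 B(2) supp poly in auto)
  then have "ext.dim ((\<lambda>t. \<phi> t y) ` T) \<le> card ((\<lambda>t. \<phi> t y) ` T0)"
    using \<open>finite T0\<close> by (intro ext.dim_le_card) auto
  also have "\<dots> \<le> card T0" by (rule card_image_le) fact
  also have "\<dots> = card B" using T0 by (simp add: card_image)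
  finally show ?thesis using B(3) by simp
qed

lemma dim_image_eq_card_iff:
  fixes \<phi> :: "'t \<Rightarrow> ext_elem"
  assumes "finite T"
  shows "ext.dim (\<phi> ` T) = card T \<longleftrightarrow> (\<forall>t\<in>T. \<phi> t \<notin> ext.span (\<phi> ` (T - {t})))"
proof
  assume L: "ext.dim (\<phi> ` T) = card T"
  show "\<forall>t\<in>T. \<phi> t \<notin> ext.span (\<phi> ` (T - {t}))"
  proof (intro ballI notI)
    fix t assume t: "t \<in> T" "\<phi> t \<in> ext.span (\<phi> ` (T - {t}))"
    have "\<phi> ` T \<subseteq> ext.span (\<phi> ` (T - {t}))"
    proof
      fix z assume "z \<in> \<phi> ` T"
      then obtain s where "s \<in> T" "z = \<phi> s" by blast
      then show "z \<in> ext.span (\<phi> ` (T - {t}))"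
        using t by (cases "s = t") (auto intro: ext.span_base)
    qed
    then have "ext.dim (\<phi> ` T) \<le> card (\<phi> ` (T - {t}))"
      using assms by (intro ext.dim_le_card) auto
    also have "\<dots> \<le> card (T - {t})" using assms by (intro card_image_le) auto
    also have "\<dots> < card T" using assms t(1) by (rule card_Diff1_less)
    finally show False using L by simp
  qed
next
  assume R: "\<forall>t\<in>T. \<phi> t \<notin> ext.span (\<phi> ` (T - {t}))"
  have inj: "inj_on \<phi> T"
  proof (rule inj_onI, rule ccontr)
    fix s t assume st: "s \<in> T" "t \<in> T" "\<phi> s = \<phi> t" "s \<noteq> t"
    have "\<phi> s \<in> \<phi> ` (T - {s})" by (rule image_eqI[of _ _ t]) (use st in auto)
    then have "\<phi> s \<in> ext.span (\<phi> ` (T - {s}))" by (rule ext.span_base)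
    then show False using R st(1) by blast
  qed
  have "ext.independent (\<phi> ` T)"
  proof (unfold ext.dependent_def, rule notI)
    assume "\<exists>a\<in>\<phi> ` T. a \<in> ext.span (\<phi> ` T - {a})"
    then obtain t where t: "t \<in> T" "\<phi> t \<in> ext.span (\<phi> ` T - {\<phi> t})" by blast
    have "\<phi> ` T - {\<phi> t} \<subseteq> \<phi> ` (T - {t})" by auto
    then have "\<phi> t \<in> ext.span (\<phi> ` (T - {t}))" using t(2) ext.span_mono by blast
    then show False using R t(1) by blast
  qed
  then have "ext.dim (\<phi> ` T) = card (\<phi> ` T)" by (rule ext.dim_eq_card_independent)
  then show "ext.dim (\<phi> ` T) = card T" by (simp add: card_image[OF inj])
qed

text \<open>An expression of the nonzero vector \<open>\<phi> t0\<close> by the others has a nonzero term, and can be solved for the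
  vector in that term.\<close>

lemma not_in_span_of_rest_if_others_not:
  assumes "finite T" "t0 \<in> T" "\<phi> t0 \<noteq> 0"
    and others: "\<And>t. t \<in> T - {t0} \<Longrightarrow> \<phi> t \<notin> ext.span (\<phi> ` (T - {t}))"
  shows "\<phi> t0 \<notin> ext.span (\<phi> ` (T - {t0}))"
proof
  assume "\<phi> t0 \<in> ext.span (\<phi> ` (T - {t0}))"
  then obtain u where u: "\<phi> t0 = (\<Sum>t\<in>T - {t0}. ext_scale (u t) (\<phi> t))"
    using ext_span_image_iff[of "T - {t0}"] \<open>finite T\<close> by auto
  have "\<exists>t\<in>T - {t0}. ext_scale (u t) (\<phi> t) \<noteq> 0"
  proof (rule ccontr)
    assume "\<not> (\<exists>t\<in>T - {t0}. ext_scale (u t) (\<phi> t) \<noteq> 0)"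
    then have "(\<Sum>t\<in>T - {t0}. ext_scale (u t) (\<phi> t)) = 0" by (intro sum.neutral) blast
    then show False using assms(3) u by (simp only: simp_thms)
  qed
  then obtain t where t: "t \<in> T - {t0}" "ext_scale (u t) (\<phi> t) \<noteq> 0" by blast
  then have ut: "u t \<noteq> 0" by (auto simp: ext_scale_def fun_eq_iff)
  have "\<phi> t0 = ext_scale (u t) (\<phi> t) + (\<Sum>s\<in>T - {t0} - {t}. ext_scale (u s) (\<phi> s))"
    unfolding u by (rule sum.remove) (use t \<open>finite T\<close> in auto)
  then have "ext_scale (u t) (\<phi> t) = \<phi> t0 - (\<Sum>s\<in>T - {t0} - {t}. ext_scale (u s) (\<phi> s))"
    by (simp add: algebra_simps)
  also have "\<dots> \<in> ext.span (\<phi> ` (T - {t}))"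
    using t(1) assms(2) by (intro ext.span_diff ext.span_sum ext.span_scale ext.span_base) auto
  finally have "ext_scale (1 / u t) (ext_scale (u t) (\<phi> t)) \<in> ext.span (\<phi> ` (T - {t}))"
    by (rule ext.span_scale)
  then have "\<phi> t \<in> ext.span (\<phi> ` (T - {t}))" using ut by (simp add: ext_scale_def)
  then show False using others[OF t(1)] by blast
qed


section \<open>Wedge products with vectors\<close>

lemma wedge_nonzeroE:
  assumes "wedge x y T \<noteq> 0"
  obtains A where "A \<subseteq> T" "x A \<noteq> 0" "y (T - A) \<noteq> 0"
proof -
  obtain A where "A \<in> Pow T"
    "(-1) ^ card {(i, j). i \<in> A \<and> j \<in> T - A \<and> j < i} * x A * y (T - A) \<noteq> 0"
    using assms unfolding wedge_def by (rule sum.not_neutral_contains_not_neutral)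
  then show thesis using that[of A] by auto
qed

lemma ext_vector_singleton: "ext_vector n a {v} = (if v \<in> {1..n} then a v else 0)"
  unfolding ext_vector_def sum_ext_apply ext_scale_apply ext_basis_def
  by (simp add: if_distrib[of "(*) _"] cong: if_cong)

lemma ext_vector_non_singleton: "(\<And>v. v \<in> {1..n} \<Longrightarrow> S \<noteq> {v}) \<Longrightarrow> ext_vector n a S = 0"
  unfolding ext_vector_def sum_ext_apply ext_scale_apply ext_basis_def
  by (intro sum.neutral) auto

lemma ext_vector_unit: "v \<in> {1..n} \<Longrightarrow> ext_vector n (\<lambda>w. of_bool (w = v)) = ext_basis {v}"
  unfolding ext_vector_def
  by (auto simp: fun_eq_iff sum_ext_apply ext_scale_apply of_bool_def if_distrib[of "\<lambda>c. c * _"] cong: if_cong)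

lemma ext_vector_cong: "(\<And>v. v \<in> {1..n} \<Longrightarrow> a v = b v) \<Longrightarrow> ext_vector n a = ext_vector n b"
  unfolding ext_vector_def by (intro sum.cong) auto

text \<open>The sign of \<open>e\<^sub>v \<and> e\<^bsub>S - {v}\<^esub> = \<plusminus> e\<^sub>S\<close>.\<close>

definition insertion_sign :: "nat set \<Rightarrow> nat \<Rightarrow> real" where
  "insertion_sign S v = (-1) ^ card {j \<in> S. j < v}"

lemma wedge_infinite: "infinite S \<Longrightarrow> wedge x y S = 0"
  unfolding wedge_def by simp

text \<open>Only singletons contribute to the first factor, which turns the product into a sum over single
  elements: the shape of a Laplace expansion along the first row.\<close>

lemma wedge_ext_vector:
  assumes "finite S"
  shows "wedge (ext_vector n a) y S =
    (\<Sum>v\<in>S \<inter> {1..n}. insertion_sign S v * a v * y (S - {v}))"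
proof -
  let ?g = "\<lambda>A. (-1) ^ card {(i, j). i \<in> A \<and> j \<in> S - A \<and> j < i} * ext_vector n a A * y (S - A)"
  have sub: "(\<lambda>v. {v}) ` (S \<inter> {1..n}) \<subseteq> Pow S" by auto
  have "wedge (ext_vector n a) y S = (\<Sum>A\<in>(\<lambda>v. {v}) ` (S \<inter> {1..n}). ?g A)"
    unfolding wedge_def
  proof (rule sum.mono_neutral_right[OF _ sub])
    show "\<forall>A\<in>Pow S - (\<lambda>v. {v}) ` (S \<inter> {1..n}). ?g A = 0"
    proof
      fix A assume A: "A \<in> Pow S - (\<lambda>v. {v}) ` (S \<inter> {1..n})"
      have "ext_vector n a A = 0" by (rule ext_vector_non_singleton) (use A in auto)
      then show "?g A = 0" by simp
    qed
  qed (use assms in simp)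
  also have "\<dots> = (\<Sum>v\<in>S \<inter> {1..n}. ?g {v})"
    by (subst sum.reindex) auto
  also have "\<dots> = (\<Sum>v\<in>S \<inter> {1..n}. insertion_sign S v * a v * y (S - {v}))"
  proof (rule sum.cong[OF refl])
    fix v assume v: "v \<in> S \<inter> {1..n}"
    have "{(i, j). i \<in> {v} \<and> j \<in> S - {v} \<and> j < i} = Pair v ` {j \<in> S. j < v}" by auto
    then have "card {(i, j). i \<in> {v} \<and> j \<in> S - {v} \<and> j < i} = card {j \<in> S. j < v}"
      by (simp add: card_image inj_on_def)
    then show "?g {v} = insertion_sign S v * a v * y (S - {v})"
      using v by (simp add: insertion_sign_def ext_vector_singleton)
  qed
  finally show ?thesis .
qed

text \<open>Removing the smaller of the two elements changes the position of the larger one by one, but not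
  conversely.\<close>

lemma insertion_sign_swap:
  assumes "finite S" "v \<in> S" "w \<in> S" "v \<noteq> w"
  shows "insertion_sign S v * insertion_sign (S - {v}) w = - (insertion_sign S w * insertion_sign (S - {w}) v)"
proof -
  have *: "insertion_sign S v * insertion_sign (S - {v}) w = - (insertion_sign S w * insertion_sign (S - {w}) v)"
    if "v \<in> S" "w \<in> S" "v < w" for v w
  proof -
    have "{j \<in> S. j < w} = insert v {j \<in> S - {v}. j < w}" using that by auto
    then have "card {j \<in> S. j < w} = Suc (card {j \<in> S - {v}. j < w})"
      using assms(1) by simp
    moreover have "{j \<in> S - {w}. j < v} = {j \<in> S. j < v}" using that by auto
    ultimately show ?thesis by (simp add: insertion_sign_def)
  qed
  show ?thesis
    using *[of v w] *[of w v] assms by (cases "v < w") auto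
qed

lemma wedge_ext_vector_anticommute:
  "wedge (ext_vector n a) (wedge (ext_vector n b) y) = - wedge (ext_vector n b) (wedge (ext_vector n a) y)"
proof
  fix S :: "nat set"
  show "wedge (ext_vector n a) (wedge (ext_vector n b) y) S
      = (- wedge (ext_vector n b) (wedge (ext_vector n a) y)) S"
  proof (cases "finite S")
    case False
    then show ?thesis by (simp add: wedge_infinite)
  next
    case True
    let ?S = "S \<inter> {1..n}"
    \<comment> \<open>The term in which \<open>a\<close> takes \<open>v\<close> and \<open>b\<close> takes \<open>w\<close>; exchanging the two vectors exchanges \<open>v\<close> and \<open>w\<close>.\<close>
    define g where "g a b v w = (if v = w then 0 else
      insertion_sign S v * insertion_sign (S - {v}) w * a v * b w * y (S - {v, w}))"
      for a b :: "nat \<Rightarrow> real" and v w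
    have expand: "wedge (ext_vector n a) (wedge (ext_vector n b) y) S = (\<Sum>v\<in>?S. \<Sum>w\<in>?S. g a b v w)"
      for a b
    proof -
      have "insertion_sign S v * a v * wedge (ext_vector n b) y (S - {v}) = (\<Sum>w\<in>?S. g a b v w)"
        if "v \<in> ?S" for v
      proof -
        have "insertion_sign S v * a v * wedge (ext_vector n b) y (S - {v})
            = (\<Sum>w\<in>?S - {v}. g a b v w)"
          using True by (subst wedge_ext_vector)
            (auto simp: g_def sum_distrib_left insert_commute Diff_insert[symmetric] mult_ac intro!: sum.cong)
        also have "\<dots> = (\<Sum>w\<in>?S. g a b v w)"
          by (rule sum.mono_neutral_left) (use True in \<open>auto simp: g_def\<close>)
        finally show ?thesis .
      qed
      then show ?thesis using True by (simp add: wedge_ext_vector)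
    qed
    have "g a b v w = - g b a w v" if "v \<in> ?S" "w \<in> ?S" for v w
      using insertion_sign_swap[of S v w] that True
      by (auto simp: g_def insert_commute)
    then have "(\<Sum>v\<in>?S. \<Sum>w\<in>?S. g a b v w) = (\<Sum>v\<in>?S. \<Sum>w\<in>?S. - g b a w v)"
      by (intro sum.cong refl) auto
    also have "\<dots> = - (\<Sum>w\<in>?S. \<Sum>v\<in>?S. g b a w v)"
      by (subst sum.swap) (simp add: sum_negf)
    finally show ?thesis by (simp add: expand)
  qed
qed

lemma wedge_ext_vector_self: "wedge (ext_vector n a) (wedge (ext_vector n a) y) = 0"
proof
  fix S
  show "wedge (ext_vector n a) (wedge (ext_vector n a) y) S = 0 S"
    using fun_cong[OF wedge_ext_vector_anticommute[of n a a y], of S] by simp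
qed

lemma wedge_scale_right: "wedge x (ext_scale c y) = ext_scale c (wedge x y)"
  by (auto simp: fun_eq_iff wedge_def ext_scale_def sum_distrib_left mult_ac intro!: sum.cong)

lemma wedge_add_right: "wedge x (y + z) = wedge x y + wedge x z"
  by (auto simp: fun_eq_iff wedge_def algebra_simps sum.distrib)

lemma wedge_zero_right: "wedge x 0 = 0"
  by (auto simp: fun_eq_iff wedge_def)

lemma wedge_uminus_right: "wedge x (- y) = - wedge x y"
  by (auto simp: fun_eq_iff wedge_def sum_negf)

lemma wedge_scale_left: "wedge (ext_scale c x) y = ext_scale c (wedge x y)"
  by (auto simp: fun_eq_iff wedge_def ext_scale_def sum_distrib_left mult_ac intro!: sum.cong)

lemma wedge_add_left: "wedge (x + x') y = wedge x y + wedge x' y"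
  by (auto simp: fun_eq_iff wedge_def algebra_simps sum.distrib)

lemma wedge_zero_left: "wedge 0 y = 0"
  by (auto simp: fun_eq_iff wedge_def)

lemma wedge_sum_left: "wedge (\<Sum>a\<in>A. x a) y = (\<Sum>a\<in>A. wedge (x a) y)"
  by (induction A rule: infinite_finite_induct) (simp_all only: simp_thms sum.infinite sum.empty sum.insert wedge_add_left wedge_zero_left)

definition wedge_list :: "nat \<Rightarrow> (nat \<Rightarrow> real) list \<Rightarrow> ext_elem" where
  "wedge_list n L = foldr wedge (map (ext_vector n) L) (ext_basis {})"

lemma wedge_list_simps [simp]:
  "wedge_list n [] = ext_basis {}"
  "wedge_list n (a # L) = wedge (ext_vector n a) (wedge_list n L)"
  by (simp_all add: wedge_list_def)

lemma ext_family_eq_wedge_list: "ext_family n f \<sigma> = wedge_list n (map f (sorted_list_of_set \<sigma>))"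
  by (simp add: ext_family_def wedge_list_def comp_def)

definition eq_up_to_sign :: "ext_elem \<Rightarrow> ext_elem \<Rightarrow> bool" where
  "eq_up_to_sign x y \<longleftrightarrow> x = y \<or> x = - y"

lemma eq_up_to_sign_sym: "eq_up_to_sign x y \<Longrightarrow> eq_up_to_sign y x"
  unfolding eq_up_to_sign_def by auto

lemma eq_up_to_sign_trans: "eq_up_to_sign x y \<Longrightarrow> eq_up_to_sign y z \<Longrightarrow> eq_up_to_sign x z"
  unfolding eq_up_to_sign_def by auto

lemma eq_up_to_sign_in_span:
  "eq_up_to_sign x y \<Longrightarrow> y \<in> ext.span B \<Longrightarrow> x \<in> ext.span B"
  unfolding eq_up_to_sign_def by (auto simp: ext.span_neg)

lemma eq_up_to_sign_wedge: "eq_up_to_sign x y \<Longrightarrow> eq_up_to_sign (wedge a x) (wedge a y)"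
  unfolding eq_up_to_sign_def by (auto simp: wedge_uminus_right)

lemma wedge_list_move_to_front:
  "eq_up_to_sign (wedge_list n (xs @ a # ys)) (wedge_list n (a # xs @ ys))"
proof (induction xs)
  case Nil
  show ?case by (simp add: eq_up_to_sign_def)
next
  case (Cons b xs)
  from eq_up_to_sign_wedge[OF Cons, of "ext_vector n b"]
  have "eq_up_to_sign (wedge_list n ((b # xs) @ a # ys))
      (wedge (ext_vector n b) (wedge (ext_vector n a) (wedge_list n (xs @ ys))))" by simp
  then show ?case
    by (subst (asm) wedge_ext_vector_anticommute) (auto simp: eq_up_to_sign_def)
qed

text \<open>Exact signs are never needed: all uses concern spans.\<close>

lemma wedge_list_permute:
  "mset L = mset L' \<Longrightarrow> eq_up_to_sign (wedge_list n L) (wedge_list n L')"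
proof (induction L' arbitrary: L)
  case Nil
  then show ?case by (simp add: eq_up_to_sign_def)
next
  case (Cons a L')
  then have "a \<in> set L" by (metis list.set_intros(1) mset_eq_setD)
  then obtain xs ys where L: "L = xs @ a # ys" by (meson split_list)
  then have "mset (xs @ ys) = mset L'" using Cons.prems by simp
  then have "eq_up_to_sign (wedge_list n (a # xs @ ys)) (wedge_list n (a # L'))"
    using eq_up_to_sign_wedge[OF Cons.IH] by simp
  then show ?case using wedge_list_move_to_front L eq_up_to_sign_trans by blast
qed

lemma wedge_list_repeated: "a \<in> set L \<Longrightarrow> wedge_list n (a # L) = 0"
proof -
  assume "a \<in> set L"
  then obtain xs ys where "L = xs @ a # ys" by (meson split_list)
  then have "eq_up_to_sign (wedge_list n L) (wedge_list n (a # xs @ ys))"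
    using wedge_list_move_to_front by blast
  then have "eq_up_to_sign (wedge_list n (a # L)) (wedge (ext_vector n a) (wedge_list n (a # xs @ ys)))"
    using eq_up_to_sign_wedge by simp
  then show ?thesis by (auto simp: wedge_ext_vector_self eq_up_to_sign_def)
qed

lemma wedge_list_eq_ext_family:
  assumes "distinct l"
  shows "eq_up_to_sign (wedge_list n (map f l)) (ext_family n f (set l))"
  unfolding ext_family_eq_wedge_list
  by (rule wedge_list_permute) (use assms in \<open>simp add: sorted_list_of_set_sort_remdups distinct_remdups_id\<close>)

lemma ext_family_permute:
  assumes "inj \<pi>" "finite \<tau>"
  shows "eq_up_to_sign (ext_family n (\<lambda>i. f (\<pi> i)) \<tau>) (ext_family n f (\<pi> ` \<tau>))"
proof -
  have "distinct (map \<pi> (sorted_list_of_set \<tau>))"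
    using inj_on_subset[OF assms(1) subset_UNIV] by (simp add: distinct_map)
  from wedge_list_eq_ext_family[OF this, of n f] show ?thesis
    using assms(2) by (simp add: ext_family_eq_wedge_list comp_def)
qed

lemma wedge_list_support: "wedge_list n L S \<noteq> 0 \<Longrightarrow> S \<subseteq> {1..n} \<and> card S = length L"
proof (induction L arbitrary: S)
  case Nil
  then show ?case by (auto simp: ext_basis_def split: if_splits)
next
  case (Cons a L)
  have fin: "finite S" using Cons.prems wedge_infinite by force
  obtain v where v: "v \<in> S \<inter> {1..n}" "wedge_list n L (S - {v}) \<noteq> 0"
    using Cons.prems fin by (auto simp: wedge_ext_vector elim!: sum.not_neutral_contains_not_neutral)
  then have "S \<subseteq> {1..n}" using Cons.IH[OF v(2)] by auto
  moreover have "Suc (card (S - {v})) = card S" using card_Suc_Diff1[OF fin, of v] v(1) by blast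
  ultimately show ?case using Cons.IH[OF v(2)] by simp
qed

lemma ext_family_in_carrier: "ext_family n f \<sigma> \<in> ext_carrier n"
  unfolding ext_carrier_def ext_family_eq_wedge_list using wedge_list_support by blast

lemma ext_family_cong:
  assumes "\<And>i v. i \<in> \<sigma> \<Longrightarrow> v \<in> {1..n} \<Longrightarrow> f i v = g i v"
  shows "ext_family n f \<sigma> = ext_family n g \<sigma>"
proof (cases "finite \<sigma>")
  case True
  then have "map (\<lambda>i. ext_vector n (f i)) (sorted_list_of_set \<sigma>)
      = map (\<lambda>i. ext_vector n (g i)) (sorted_list_of_set \<sigma>)"
    using assms by (auto intro: ext_vector_cong)
  then show ?thesis by (simp only: ext_family_def)
qed (simp add: ext_family_def)


section \<open>Coefficients of wedge products as minors\<close>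

definition delete_nth :: "nat \<Rightarrow> 'a list \<Rightarrow> 'a list" where
  "delete_nth i xs = take i xs @ drop (Suc i) xs"

lemma length_delete_nth: "i < length xs \<Longrightarrow> length (delete_nth i xs) = length xs - 1"
  by (auto simp: delete_nth_def)

lemma nth_delete_nth:
  "i < length xs \<Longrightarrow> k < length xs - 1 \<Longrightarrow> delete_nth i xs ! k = xs ! (if k < i then k else Suc k)"
  by (auto simp: delete_nth_def nth_append min_def)

lemma map_delete_nth: "map h (delete_nth j xs) = delete_nth j (map h xs)"
  by (simp add: delete_nth_def take_map drop_map)

lemma distinct_delete_nth:
  assumes "distinct xs" "i < length xs"
  shows "distinct (delete_nth i xs)" "set (delete_nth i xs) = set xs - {xs ! i}"
proof -
  have xs: "xs = take i xs @ xs ! i # drop (Suc i) xs" using assms(2) by (simp add: id_take_nth_drop)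
  then have "distinct (take i xs @ xs ! i # drop (Suc i) xs)" using assms(1) by simp
  moreover from xs have "set xs = set (take i xs) \<union> insert (xs ! i) (set (drop (Suc i) xs))"
    by (metis list.set(2) set_append)
  ultimately show "distinct (delete_nth i xs)" "set (delete_nth i xs) = set xs - {xs ! i}"
    unfolding delete_nth_def by auto
qed

lemma sorted_delete_nth:
  fixes s :: "nat list"
  assumes "sorted_wrt (<) s" "i < length s"
  shows "sorted_wrt (<) (delete_nth i s)" "set (delete_nth i s) = set s - {s ! i}"
proof -
  have "sorted_wrt (<) (take i s @ s ! i # drop (Suc i) s)"
    using assms id_take_nth_drop[OF assms(2)] by simp
  then show "sorted_wrt (<) (delete_nth i s)"
    unfolding delete_nth_def by (auto simp: sorted_wrt_append)
  show "set (delete_nth i s) = set s - {s ! i}"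
    using assms distinct_delete_nth(2)[of s i] by (simp add: strict_sorted_iff)
qed

lemma insertion_sign_nth:
  assumes "sorted_wrt (<) s" "i < length s"
  shows "insertion_sign (set s) (s ! i) = (-1) ^ i"
proof -
  have lt: "s ! a < s ! b \<longleftrightarrow> a < b" if "a < length s" "b < length s" for a b
    using assms(1) that sorted_wrt_nth_less by (metis linorder_neqE_nat not_less_iff_gr_or_eq)
  have "{j \<in> set s. j < s ! i} = (!) s ` {..<i}"
  proof (intro equalityI subsetI)
    fix j assume "j \<in> {j \<in> set s. j < s ! i}"
    then obtain k where "k < length s" "j = s ! k" "s ! k < s ! i"
      by (auto simp: in_set_conv_nth)
    then show "j \<in> (!) s ` {..<i}" using lt[of k i] assms(2) by auto
  next
    fix j assume "j \<in> (!) s ` {..<i}"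
    then obtain k where "k < i" "j = s ! k" by auto
    then show "j \<in> {j \<in> set s. j < s ! i}" using lt[of k i] assms(2) by auto
  qed
  moreover have "inj_on ((!) s) {..<i}"
    using assms by (intro inj_on_nth) (auto simp: strict_sorted_iff)
  ultimately show ?thesis by (simp add: insertion_sign_def card_image)
qed

definition coordinate_minor :: "(nat \<Rightarrow> real) list \<Rightarrow> nat list \<Rightarrow> real mat" where
  "coordinate_minor L s = mat (length L) (length s) (\<lambda>(a, b). (L ! a) (s ! b))"

lemma mat_delete_coordinate_minor:
  assumes "a < length L" "b < length s"
  shows "mat_delete (coordinate_minor L s) a b = coordinate_minor (delete_nth a L) (delete_nth b s)"
  unfolding coordinate_minor_def mat_delete_def
  by (rule eq_matI) (use assms in \<open>auto simp: length_delete_nth nth_delete_nth\<close>)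

text \<open>Expanding the determinant along its first row is the same recursion as wedging with the first vector
  of the list.\<close>

lemma wedge_list_eq_det:
  assumes "sorted_wrt (<) s" "set s \<subseteq> {1..n}" "length s = length L"
  shows "wedge_list n L (set s) = det (coordinate_minor L s)"
  using assms
proof (induction L arbitrary: s)
  case Nil
  then show ?case by (simp add: ext_basis_def coordinate_minor_def)
next
  case (Cons a L)
  let ?k = "length s"
  have dist: "distinct s" using Cons.prems(1) strict_sorted_iff by blast
  have "wedge_list n (a # L) (set s)
      = (\<Sum>v\<in>set s. insertion_sign (set s) v * a v * wedge_list n L (set s - {v}))"
    using Cons.prems(2) by (simp add: wedge_ext_vector Int_absorb2)
  also have "\<dots> = (\<Sum>i<?k. insertion_sign (set s) (s ! i) * a (s ! i) * wedge_list n L (set s - {s ! i}))"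
    by (rule sum.reindex_bij_betw[symmetric]) (rule bij_betw_nth[OF dist], auto)
  also have "\<dots> = (\<Sum>i<?k. coordinate_minor (a # L) s $$ (0, i) * cofactor (coordinate_minor (a # L) s) 0 i)"
  proof (rule sum.cong[OF refl])
    fix i assume "i \<in> {..<?k}"
    then have i: "i < ?k" by simp
    have "wedge_list n L (set s - {s ! i}) = det (coordinate_minor L (delete_nth i s))"
      using Cons.IH[of "delete_nth i s"] sorted_delete_nth[OF Cons.prems(1) i] Cons.prems i
      by (auto simp: length_delete_nth)
    moreover have "mat_delete (coordinate_minor (a # L) s) 0 i = coordinate_minor L (delete_nth i s)"
      using mat_delete_coordinate_minor[of 0 "a # L" i s] i by (simp add: delete_nth_def)
    ultimately show "insertion_sign (set s) (s ! i) * a (s ! i) * wedge_list n L (set s - {s ! i})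
        = coordinate_minor (a # L) s $$ (0, i) * cofactor (coordinate_minor (a # L) s) 0 i"
      using insertion_sign_nth[OF Cons.prems(1) i] i
      by (simp add: cofactor_def coordinate_minor_def)
  qed
  also have "\<dots> = det (coordinate_minor (a # L) s)"
    by (rule laplace_expansion_row[symmetric]) (use Cons.prems in \<open>auto simp: coordinate_minor_def\<close>)
  finally show ?case .
qed

text \<open>Replacing row \<open>j\<close> of a minor by a unit vector gives the cofactor at that row. The sign \<open>(-1) ^ j\<close> comes
  from moving the unit vector to the front.\<close>

lemma cofactor_coordinate_minor:
  assumes "sorted_wrt (<) s" "set s \<subseteq> {1..n}" "length s = length L" "j < length L" "i < length s"
  shows "cofactor (coordinate_minor L s) j i
    = (-1) ^ j * wedge_list n ((\<lambda>w. of_bool (w = s ! i)) # delete_nth j L) (set s)"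
proof -
  have si: "s ! i \<in> set s \<inter> {1..n}" using nth_mem[OF assms(5)] assms(2) by blast
  have "wedge_list n ((\<lambda>w. of_bool (w = s ! i)) # delete_nth j L) (set s)
      = (\<Sum>v\<in>set s \<inter> {1..n}. if v = s ! i then
           insertion_sign (set s) v * wedge_list n (delete_nth j L) (set s - {v}) else 0)"
    unfolding wedge_list_simps wedge_ext_vector[OF finite_set] by (rule sum.cong) simp_all
  also have "\<dots> = (-1) ^ i * wedge_list n (delete_nth j L) (set s - {s ! i})"
    using si by (subst sum.delta) (auto simp: insertion_sign_nth[OF assms(1,5)])
  also have "wedge_list n (delete_nth j L) (set s - {s ! i})
      = det (coordinate_minor (delete_nth j L) (delete_nth i s))"
    using wedge_list_eq_det[of "delete_nth i s" n "delete_nth j L"]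
      sorted_delete_nth[OF assms(1,5)] assms by (auto simp: length_delete_nth)
  finally have "wedge_list n ((\<lambda>w. of_bool (w = s ! i)) # delete_nth j L) (set s)
      = (-1) ^ i * det (coordinate_minor (delete_nth j L) (delete_nth i s))" .
  then show ?thesis
    unfolding cofactor_def mat_delete_coordinate_minor[OF assms(4,5)] power_add
    by (simp only: mult.assoc)
qed


section \<open>Row rank and column rank\<close>

text \<open>The rank of a matrix, defined by its columns, is the least inner dimension of a factorization. This
  symmetric characterization, the two halves of which are this lemma and the next one, is what relates
  the rank to the rows.\<close>

lemma rank_mult_le:
  fixes X :: "real mat"
  assumes X: "X \<in> carrier_mat nr s" and Y: "Y \<in> carrier_mat s nc"
  shows "vec_space.rank nr (X * Y) \<le> s"
proof -
  interpret vec_space "TYPE(real)" nr .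
  have XY: "X * Y \<in> carrier_mat nr nc" using X Y by auto
  have cX: "set (cols X) \<subseteq> carrier_vec nr" using cols_dim X by blast
  have cXY: "set (cols (X * Y)) \<subseteq> carrier_vec nr" using cols_dim XY by blast
  have "set (cols (X * Y)) \<subseteq> span (set (cols X))"
  proof
    fix v assume "v \<in> set (cols (X * Y))"
    then obtain j where j: "j < nc" "v = col (X * Y) j"
      using X Y by (auto simp: cols_def simp del: col_mult2)
    have "v = X *\<^sub>v col Y j" unfolding j(2) by (rule col_mult2[OF X Y j(1)])
    moreover have "col Y j \<in> carrier_vec s" using Y by (intro carrier_vecI) simp
    ultimately have "v \<in> carrier_vec nr \<and> (\<exists>y\<in>carrier_vec s. X *\<^sub>v y = v)"
      using X mult_mat_vec_carrier by blast
    then have "v \<in> col_space X" unfolding col_space_eq[OF X] using X by simp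
    then show "v \<in> span (set (cols X))" by (simp add: col_space_def)
  qed
  then have sub: "span (set (cols (X * Y))) \<subseteq> span (set (cols X))"
    by (rule span_subsetI[OF cX])
  have "subspace class_ring (span (set (cols (X * Y)))) (vs (span (set (cols X))))"
    by (rule nested_subspaces[OF span_is_subspace[OF cX] span_is_subspace[OF cXY] sub])
  then have "rank (X * Y) \<le> rank X"
    unfolding rank_def
    using vectorspace.subspace_dim[OF subspace_is_vs[OF span_is_subspace[OF cX]]]
      fin_dim_span_cols[OF X] fin_dim_span_cols[OF XY] by auto
  also have "\<dots> \<le> s" by (rule rank_le_nc[OF X])
  finally show ?thesis .
qed

lemma rank_factorization:
  fixes A :: "real mat"
  assumes A: "A \<in> carrier_mat nr nc"
  shows "\<exists>X Y. X \<in> carrier_mat nr (vec_space.rank nr A) \<and>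
    Y \<in> carrier_mat (vec_space.rank nr A) nc \<and> A = X * Y"
proof -
  interpret vec_space "TYPE(real)" nr .
  have cA: "set (cols A) \<subseteq> carrier_vec nr" using cols_dim A by blast
  obtain S where S: "finite S" "maximal S (\<lambda>T. T \<subseteq> set (cols A) \<and> lin_indpt T)"
    using maximal_exists_superset[of "set (cols A)" "\<lambda>T. T \<subseteq> set (cols A) \<and> lin_indpt T" "{}"]
      finite_lin_indpt2 by auto
  have r: "rank A = card S" by (rule rank_card_indpt[OF A S(2)])
  have SA: "S \<subseteq> set (cols A)" "lin_indpt S" using S(2) unfolding maximal_def by auto
  then have cS: "S \<subseteq> carrier_vec nr" using cA by blast
  \<comment> \<open>A maximal independent set of columns spans all columns.\<close>
  have inspan: "v \<in> span S" if v: "v \<in> set (cols A)" for v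
  proof (rule ccontr)
    assume nv: "v \<notin> span S"
    then have "v \<notin> S" using cS span_mem by blast
    then have "lin_indpt (S \<union> {v})"
      using lin_dep_iff_in_span[of S v] nv SA(2) cS v cA by auto
    then show False
      using S(2) SA v \<open>v \<notin> S\<close> unfolding maximal_def by blast
  qed
  obtain l where l: "set l = S" "distinct l" using finite_distinct_list[OF S(1)] by blast
  define X where "X = mat_of_cols nr l"
  have X: "X \<in> carrier_mat nr (rank A)"
    using distinct_card[OF l(2)] mat_of_cols_carrier(1)[of nr l] unfolding X_def r l(1) by simp
  have colsX: "cols X = l" unfolding X_def using cS l by (simp add: cols_mat_of_cols)
  have "\<exists>x\<in>carrier_vec (rank A). X *\<^sub>v x = col A j" if "j < nc" for j
  proof -
    have "col A j \<in> set (cols A)" using that A by (auto simp: cols_def)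
    then have "col A j \<in> col_space X" using inspan colsX l by (simp add: col_space_def)
    then show ?thesis using X by (subst (asm) col_space_eq) auto
  qed
  then obtain y where y: "\<And>j. j < nc \<Longrightarrow> y j \<in> carrier_vec (rank A) \<and> X *\<^sub>v y j = col A j" by metis
  define Y where "Y = mat (rank A) nc (\<lambda>(t, j). y j $ t)"
  have Y: "Y \<in> carrier_mat (rank A) nc" by (simp add: Y_def)
  have "A = X * Y"
  proof (rule eq_matI)
    fix i j assume "i < dim_row (X * Y)" "j < dim_col (X * Y)"
    then have ij: "i < nr" "j < nc" using X Y by auto
    have "col Y j = y j" using y[OF ij(2)] ij by (auto simp: Y_def)
    then have "(X * Y) $$ (i, j) = (X *\<^sub>v y j) $ i" using X Y ij by simp
    then show "A $$ (i, j) = (X * Y) $$ (i, j)" using y[OF ij(2)] A ij by simp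
  qed (use A X Y in auto)
  then show ?thesis using X Y by blast
qed

text \<open>Row rank equals column rank, for a matrix whose rows are exterior elements evaluated at the sets
  \<open>F 0, F 1, \<dots>\<close> outside which they vanish. A basis of the row space and a factorization of the matrix
  through an inner dimension \<open>d\<close> are two descriptions of the same data.\<close>

lemma rank_eq_dim_rows:
  fixes \<phi> :: "nat \<Rightarrow> ext_elem"
  assumes F: "inj_on F {..<nc}" and supp: "\<And>i S. i < nr \<Longrightarrow> S \<notin> F ` {..<nc} \<Longrightarrow> \<phi> i S = 0"
  shows "vec_space.rank nr (mat nr nc (\<lambda>(i, j). \<phi> i (F j))) = ext.dim (\<phi> ` {..<nr})"
proof (rule antisym)
  let ?A = "mat nr nc (\<lambda>(i, j). \<phi> i (F j))"
  let ?d = "ext.dim (\<phi> ` {..<nr})"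
  show "vec_space.rank nr ?A \<le> ?d"
  proof -
    obtain B where B: "B \<subseteq> \<phi> ` {..<nr}" "\<phi> ` {..<nr} \<subseteq> ext.span B" "card B = ?d"
      using ext.basis_exists by metis
    obtain d where d: "card B = d" by blast
    have "finite B" using B(1) finite_surj by blast
    then obtain b where "bij_betw b {0..<d} B" using ex_bij_betw_nat_finite d by metis
    then have b: "B = b ` {..<d}" by (simp add: bij_betw_def atLeast0LessThan)
    have "\<exists>u. \<phi> i = (\<Sum>t<d. ext_scale (u t) (b t))" if "i < nr" for i
      using B(2) that ext_span_image_iff[of "{..<d}" "\<phi> i" b] unfolding b by blast
    then obtain u where u: "\<And>i. i < nr \<Longrightarrow> \<phi> i = (\<Sum>t<d. ext_scale (u i t) (b t))" by metis
    have "?A = mat nr d (\<lambda>(i, t). u i t) * mat d nc (\<lambda>(t, j). b t (F j))"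
      by (rule eq_matI)
         (auto simp: scalar_prod_def u sum_ext_apply ext_scale_apply atLeast0LessThan)
    then have "vec_space.rank nr ?A \<le> d" using rank_mult_le[of _ nr d _ nc] by (metis mat_carrier)
    then show ?thesis using B(3) d by simp
  qed
  show "?d \<le> vec_space.rank nr ?A"
  proof -
    obtain r where r: "vec_space.rank nr ?A = r" by blast
    obtain X Y where XY: "X \<in> carrier_mat nr r" "Y \<in> carrier_mat r nc" "?A = X * Y"
      using rank_factorization[of ?A nr nc] unfolding r by auto
    define b where "b t S = (\<Sum>j<nc. if S = F j then Y $$ (t, j) else 0)" for t S
    have bF: "b t (F j) = Y $$ (t, j)" if "j < nc" for t j
    proof -
      have "b t (F j) = (\<Sum>k<nc. if k = j then Y $$ (t, k) else 0)"
        unfolding b_def by (rule sum.cong) (use F that in \<open>auto simp: inj_on_def\<close>)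
      then show ?thesis using that by simp
    qed
    have "\<phi> i = (\<Sum>t<r. ext_scale (X $$ (i, t)) (b t))" if i: "i < nr" for i
    proof
      fix S
      show "\<phi> i S = (\<Sum>t<r. ext_scale (X $$ (i, t)) (b t)) S"
      proof (cases "S \<in> F ` {..<nc}")
        case True
        then obtain j where j: "j < nc" "S = F j" by auto
        have "\<phi> i S = ?A $$ (i, j)" using i j by simp
        also have "\<dots> = (\<Sum>t<r. X $$ (i, t) * Y $$ (t, j))"
          unfolding XY(3) using XY(1,2) i j
          by (simp add: scalar_prod_def atLeast0LessThan)
        finally show ?thesis using j by (simp add: sum_ext_apply ext_scale_apply bF)
      next
        case False
        then have "b t S = 0" for t unfolding b_def by (intro sum.neutral) auto
        then show ?thesis using supp[OF i False] by (simp add: sum_ext_apply ext_scale_apply)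
      qed
    qed
    then have "\<phi> ` {..<nr} \<subseteq> ext.span (b ` {..<r})"
      by (auto simp: ext_span_image_iff)
    then have "?d \<le> card (b ` {..<r})" by (intro ext.dim_le_card) auto
    also have "\<dots> \<le> r" using card_image_le[of "{..<r}" b] by simp
    finally show ?thesis unfolding r .
  qed
qed


section \<open>Rows of the volume-rigidity matrix\<close>

text \<open>The canonical representative of a coset modulo the nonface ideal; the quotient \<open>\<Lambda>K\<close> is handled through
  these representatives.\<close>

definition face_part :: "nat set set \<Rightarrow> ext_elem \<Rightarrow> ext_elem" where
  "face_part K x = (\<lambda>S. if S \<in> K then x S else 0)"

lemma face_part_zero [simp]: "face_part K 0 = 0"
  by (simp add: face_part_def fun_eq_iff)

lemma face_part_add: "face_part K (x + y) = face_part K x + face_part K y"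
  by (simp add: face_part_def fun_eq_iff)

lemma face_part_uminus: "face_part K (- x) = - face_part K x"
  by (simp add: face_part_def fun_eq_iff)

lemma face_part_eq_up_to_sign:
  "eq_up_to_sign x y \<Longrightarrow> eq_up_to_sign (face_part K x) (face_part K y)"
  unfolding eq_up_to_sign_def by (auto simp: face_part_uminus)

lemma face_part_scale: "face_part K (ext_scale c x) = ext_scale c (face_part K x)"
  by (simp add: face_part_def ext_scale_def fun_eq_iff)

lemma face_part_sum: "face_part K (\<Sum>a\<in>A. x a) = (\<Sum>a\<in>A. face_part K (x a))"
  by (simp add: face_part_def fun_eq_iff sum_ext_apply)

lemma subseqs_sorted_wrt:
  "s \<in> set (subseqs xs) \<Longrightarrow> sorted_wrt P xs \<Longrightarrow> sorted_wrt P s"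
proof (induction xs arbitrary: s)
  case (Cons a xs)
  have sub: "set t \<subseteq> set xs" if "t \<in> set (subseqs xs)" for t
    using that subseqs_powset[of xs] by blast
  show ?case using Cons by (auto simp: Let_def) (use sub in blast)
qed simp

lemma facet_listsD:
  assumes "s \<in> set (facet_lists d n K)"
  shows "sorted_wrt (<) s" "set s \<subseteq> {1..n}" "length s = d" "set s \<in> K"
proof -
  have s: "s \<in> set (subseqs [1..<Suc n])" "length s = d" "set s \<in> K"
    using assms by (auto simp: facet_lists_def simp del: upt_Suc)
  show "sorted_wrt (<) s" by (rule subseqs_sorted_wrt[OF s(1)]) (rule sorted_wrt_upt)
  have "set s \<in> Pow (set [1..<Suc n])" using imageI[OF s(1), of set] unfolding subseqs_powset .
  then show "set s \<subseteq> {1..n}" by auto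
qed (use assms in \<open>auto simp: facet_lists_def\<close>)

lemma facet_lists_inj: "inj_on (\<lambda>c. set (facet_lists d n K ! c)) {..<length (facet_lists d n K)}"
proof -
  have "distinct (map set (facet_lists d n K))"
    unfolding facet_lists_def
    by (rule distinct_map_filter) (rule distinct_set_subseqs, simp)
  then show ?thesis
    by (auto simp: distinct_conv_nth inj_on_def)
qed

lemma facet_lists_surj:
  assumes "S \<in> K" "S \<subseteq> {1..n}" "card S = d"
  shows "S \<in> (\<lambda>c. set (facet_lists d n K ! c)) ` {..<length (facet_lists d n K)}"
proof -
  have "S \<in> set ` set (subseqs [1..<Suc n])" using assms(2) by (subst subseqs_powset) auto
  then obtain s where s: "s \<in> set (subseqs [1..<Suc n])" "S = set s" by blast
  have "distinct s" using subseqs_distinctD[OF s(1)] by simp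
  then have "s \<in> set (facet_lists d n K)"
    using assms s by (simp add: facet_lists_def distinct_card del: upt_Suc)
  then show ?thesis using s(2) by (auto simp: in_set_conv_nth)
qed

text \<open>The rows of the matrix \<open>M\<^bsub>p,\<sigma>\<^esub>\<close>, as functions of the vertex. The row of ones is the last one, as in the
  matrix.\<close>

definition coordinate_rows :: "nat \<Rightarrow> (nat \<times> nat \<Rightarrow> real) \<Rightarrow> (nat \<Rightarrow> real) list" where
  "coordinate_rows d x = map (\<lambda>j v. x (v, j)) [0..<d - 1] @ [\<lambda>_. 1]"

text \<open>The \<open>K\<close>-part of \<open>e\<^sub>v \<and> P\<^sub>j\<close>, where \<open>P\<^sub>j\<close> is the wedge product of all coordinate rows except row \<open>j\<close>. Up to
  sign this is a row of the volume-rigidity matrix, read as a function of the facet.\<close>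

definition rigidity_row :: "nat \<Rightarrow> nat \<Rightarrow> nat set set \<Rightarrow> nat \<times> nat \<Rightarrow> (nat \<times> nat \<Rightarrow> real) \<Rightarrow> ext_elem" where
  "rigidity_row d n K vj x = face_part K
     (wedge_list n ((\<lambda>w. of_bool (w = fst vj)) # delete_nth (snd vj) (coordinate_rows d x)))"

lemma length_coordinate_rows: "d \<ge> 1 \<Longrightarrow> length (coordinate_rows d x) = d"
  by (simp add: coordinate_rows_def)

lemma face_matrix_eq_coordinate_minor:
  assumes "d \<ge> 1" "length s = d"
  shows "face_matrix d p s = coordinate_minor (coordinate_rows d (\<lambda>(v, j). p v $ j)) s"
  unfolding face_matrix_def coordinate_minor_def
  by (rule eq_matI) (use assms in \<open>auto simp: coordinate_rows_def nth_append\<close>)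

lemma volume_rigidity_column_entry:
  assumes d: "d \<ge> 2" and s: "s \<in> set (facet_lists d n K)" and r: "r < (d - 1) * n"
  shows "volume_rigidity_column d n p s $ r =
    (-1) ^ (r mod (d - 1)) *
      rigidity_row d n K (r div (d - 1) + 1, r mod (d - 1)) (\<lambda>(v, j). p v $ j) (set s)"
proof -
  note s' = facet_listsD[OF s]
  define v where "v = r div (d - 1) + 1"
  define j where "j = r mod (d - 1)"
  have j: "j < d - 1" using d by (simp add: j_def)
  let ?L = "coordinate_rows d (\<lambda>(v, j). p v $ j)"
  have lenL: "length ?L = d" using d by (simp add: length_coordinate_rows)
  let ?w = "wedge_list n ((\<lambda>w. of_bool (w = v)) # delete_nth j ?L) (set s)"
  have "volume_rigidity_column d n p s $ r =
      (if v \<in> set s then cofactor (face_matrix d p s) j (THE i. i < d \<and> s ! i = v) else 0)"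
    using r by (simp add: volume_rigidity_column_def Let_def v_def j_def)
  also have "\<dots> = (-1) ^ j * ?w"
  proof (cases "v \<in> set s")
    case True
    then obtain i where i: "i < d" "s ! i = v" using s'(3) by (auto simp: in_set_conv_nth)
    have "distinct s" using s'(1) strict_sorted_iff by blast
    then have "(THE i. i < d \<and> s ! i = v) = i"
      using i s'(3) by (intro the_equality) (auto simp: nth_eq_iff_index_eq)
    moreover have "cofactor (face_matrix d p s) j i = (-1) ^ j * ?w"
      using face_matrix_eq_coordinate_minor[of d s p] cofactor_coordinate_minor[of s n ?L j i]
        s' i j d lenL by simp
    ultimately show ?thesis using True by simp
  next
    case False
    have "?w = 0"
      unfolding wedge_list_simps wedge_ext_vector[OF finite_set]
      by (rule sum.neutral) (use False in auto)
    then show ?thesis using False by simp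
  qed
  finally show ?thesis using s'(4) by (simp add: rigidity_row_def face_part_def v_def j_def)
qed

lemma rigidity_row_support:
  assumes "d \<ge> 1" "j < d" "rigidity_row d n K (v, j) x S \<noteq> 0"
  shows "S \<in> K" "S \<subseteq> {1..n}" "card S = d"
proof -
  show "S \<in> K" using assms(3) by (auto simp: rigidity_row_def face_part_def split: if_splits)
  have *: "wedge_list n ((\<lambda>w. of_bool (w = v)) # delete_nth j (coordinate_rows d x)) S \<noteq> 0"
    using assms(3) by (auto simp: rigidity_row_def face_part_def split: if_splits)
  show "S \<subseteq> {1..n}" "card S = d"
    using wedge_list_support[OF *] assms(1,2)
    by (auto simp: length_delete_nth length_coordinate_rows)
qed

lemma rank_volume_rigidity_matrix:
  assumes d: "d \<ge> 2"
  shows "vec_space.rank ((d - 1) * n) (volume_rigidity_matrix d n K p) =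
    ext.dim ((\<lambda>vj. rigidity_row d n K vj (\<lambda>(v, j). p v $ j)) ` ({1..n} \<times> {..<d - 1}))"
proof -
  let ?x = "\<lambda>(v, j). p v $ j"
  let ?fl = "facet_lists d n K"
  let ?F = "\<lambda>c. set (?fl ! c)"
  let ?m = "\<lambda>r. (r div (d - 1) + 1, r mod (d - 1))"
  define \<phi> where "\<phi> r = ext_scale ((-1) ^ (r mod (d - 1))) (rigidity_row d n K (?m r) ?x)" for r
  have matrix: "volume_rigidity_matrix d n K p = mat ((d - 1) * n) (length ?fl) (\<lambda>(i, j). \<phi> i (?F j))"
  proof (rule eq_matI)
    fix i j assume "i < dim_row (mat ((d - 1) * n) (length ?fl) (\<lambda>(i, j). \<phi> i (?F j)))"
      "j < dim_col (mat ((d - 1) * n) (length ?fl) (\<lambda>(i, j). \<phi> i (?F j)))"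
    then have ij: "i < (d - 1) * n" "j < length ?fl" by auto
    then have "volume_rigidity_column d n p (?fl ! j) $ i = \<phi> i (?F j)"
      using volume_rigidity_column_entry[OF d nth_mem[OF ij(2)] ij(1)]
      by (simp only: \<phi>_def ext_scale_def)
    then show "volume_rigidity_matrix d n K p $$ (i, j)
        = mat ((d - 1) * n) (length ?fl) (\<lambda>(i, j). \<phi> i (?F j)) $$ (i, j)"
      using ij by (simp add: volume_rigidity_matrix_def mat_of_cols_index)
  qed (auto simp: volume_rigidity_matrix_def)
  have rank: "vec_space.rank ((d - 1) * n) (mat ((d - 1) * n) (length ?fl) (\<lambda>(i, j). \<phi> i (?F j)))
      = ext.dim (\<phi> ` {..<(d - 1) * n})"
  proof (rule rank_eq_dim_rows[OF facet_lists_inj])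
    fix i S assume S: "S \<notin> ?F ` {..<length ?fl}"
    have "i mod (d - 1) < d - 1" using d by (intro mod_less_divisor) simp
    then have "1 \<le> d" "i mod (d - 1) < d" using d by linarith+
    note support = rigidity_row_support[OF this]
    have "rigidity_row d n K (?m i) ?x S = 0"
    proof (rule ccontr)
      assume "rigidity_row d n K (?m i) ?x S \<noteq> 0"
      then show False using facet_lists_surj[OF support] S by blast
    qed
    then show "\<phi> i S = 0" by (simp add: \<phi>_def ext_scale_def)
  qed
  have span: "ext.span (\<phi> ` {..<(d - 1) * n})
      = ext.span ((\<lambda>r. rigidity_row d n K (?m r) ?x) ` {..<(d - 1) * n})"
    unfolding \<phi>_def by (rule span_image_scale) simp
  have blocks: "?m ` {..<(d - 1) * n} = {1..n} \<times> {..<d - 1}"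
  proof (intro equalityI subsetI)
    fix vj assume "vj \<in> ?m ` {..<(d - 1) * n}"
    then obtain r where r: "r < (d - 1) * n" "vj = ?m r" by blast
    then have "r div (d - 1) < n" by (simp add: less_mult_imp_div_less mult.commute)
    then show "vj \<in> {1..n} \<times> {..<d - 1}" using r(2) d by auto
  next
    fix vj assume "vj \<in> {1..n} \<times> {..<d - 1}"
    then obtain v j where vj: "vj = (v, j)" "1 \<le> v" "v \<le> n" "j < d - 1" by auto
    define r where "r = (v - 1) * (d - 1) + j"
    have "r < (v - 1) * (d - 1) + (d - 1)" using vj by (simp add: r_def)
    also have "\<dots> = v * (d - 1)" using vj(2) by (cases v) auto
    also have "\<dots> \<le> (d - 1) * n" using vj(3) by simp
    finally have "r < (d - 1) * n" .
    moreover have "?m r = vj" using vj by (simp add: r_def)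
    ultimately show "vj \<in> ?m ` {..<(d - 1) * n}" by blast
  qed
  have "vec_space.rank ((d - 1) * n) (volume_rigidity_matrix d n K p) = ext.dim (\<phi> ` {..<(d - 1) * n})"
    unfolding matrix by (rule rank)
  also have "\<dots> = ext.dim ((\<lambda>r. rigidity_row d n K (?m r) ?x) ` {..<(d - 1) * n})"
    by (rule ext.span_eq_dim[OF span])
  also have "(\<lambda>r. rigidity_row d n K (?m r) ?x) ` {..<(d - 1) * n}
      = (\<lambda>vj. rigidity_row d n K vj ?x) ` (?m ` {..<(d - 1) * n})"
    by (rule image_image[symmetric])
  also have "?m ` {..<(d - 1) * n} = {1..n} \<times> {..<d - 1}" by (rule blocks)
  finally show ?thesis .
qed

lemma rat_polyfun_wedge_list:
  assumes "\<And>g v. g \<in> set L \<Longrightarrow> v \<in> {1..n} \<Longrightarrow> rat_polyfun I (\<lambda>x. g x v)"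
  shows "rat_polyfun I (\<lambda>x. wedge_list n (map (\<lambda>g. g x) L) S)"
  using assms
proof (induction L arbitrary: S)
  case Nil
  show ?case by (simp add: ext_basis_def rat_polyfun_0 rat_polyfun_1)
next
  case (Cons g L)
  show ?case
  proof (cases "finite S")
    case True
    have "rat_polyfun I (\<lambda>x. \<Sum>v\<in>S \<inter> {1..n}.
        insertion_sign S v * g x v * wedge_list n (map (\<lambda>g. g x) L) (S - {v}))"
      unfolding insertion_sign_def
      by (intro rat_polyfun_sum rat_polyfun_mult rat_polyfun_sign Cons) (use Cons.prems in auto)
    then show ?thesis using True by (simp add: wedge_ext_vector)
  next
    case False
    then show ?thesis by (simp add: wedge_infinite rat_polyfun_0)
  qed
qed

lemma rat_polyfun_face_part:
  "(\<And>S. rat_polyfun I (\<lambda>x. h x S)) \<Longrightarrow> rat_polyfun I (\<lambda>x. face_part K (h x) S)"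
  by (cases "S \<in> K") (simp_all add: face_part_def rat_polyfun_0)

lemma rat_polyfun_rigidity_row:
  assumes "v \<in> {1..n}" "j < d - 1"
  shows "rat_polyfun ({1..n} \<times> {..<d - 1}) (\<lambda>x. rigidity_row d n K (v, j) x S)"
proof -
  define L where "L = (\<lambda>_ w. of_bool (w = v)) #
    delete_nth j (map (\<lambda>j x v. x (v, j)) [0..<d - 1] @ [\<lambda>_ _. 1 :: real])"
  have "rat_polyfun ({1..n} \<times> {..<d - 1}) (\<lambda>x. g x w)" if "g \<in> set L" "w \<in> {1..n}" for g w
  proof -
    have "set (delete_nth j xs) \<subseteq> set xs" for xs :: "((nat \<times> nat \<Rightarrow> real) \<Rightarrow> nat \<Rightarrow> real) list"
      using set_take_subset set_drop_subset by (force simp: delete_nth_def)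
    then have "g = (\<lambda>_ w. of_bool (w = v)) \<or> (\<exists>i<d - 1. g = (\<lambda>x v. x (v, i))) \<or> g = (\<lambda>_ _. 1)"
      using that(1) unfolding L_def by fastforce
    then show ?thesis using that(2)
      by (auto simp: of_bool_def intro: rat_polyfun_0 rat_polyfun_1 rat_polyfun_var)
  qed
  then have "rat_polyfun ({1..n} \<times> {..<d - 1}) (\<lambda>x. face_part K (wedge_list n (map (\<lambda>g. g x) L)) S)"
    by (intro rat_polyfun_face_part rat_polyfun_wedge_list)
  moreover have "map (\<lambda>g. g x) L = (\<lambda>w. of_bool (w = v)) # delete_nth j (coordinate_rows d x)" for x
    by (simp add: L_def coordinate_rows_def map_delete_nth comp_def)
  ultimately show ?thesis by (simp only: rigidity_row_def fst_conv snd_conv)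
qed

text \<open>The rows of the matrix form a family with polynomial entries, so their dimension is the same at
  all generic points.\<close>

lemma rank_volume_rigidity_matrix_generic:
  assumes d: "d \<ge> 2" and "generic_map d n p" "generic_map d n p'"
  shows "vec_space.rank ((d - 1) * n) (volume_rigidity_matrix d n K p)
    = vec_space.rank ((d - 1) * n) (volume_rigidity_matrix d n K p')"
proof -
  have *: "ext.dim ((\<lambda>vj. rigidity_row d n K vj y) ` ({1..n} \<times> {..<d - 1}))
      \<le> ext.dim ((\<lambda>vj. rigidity_row d n K vj x) ` ({1..n} \<times> {..<d - 1}))"
    if "alg_indep_family ({1..n} \<times> {..<d - 1}) x" "alg_indep_family ({1..n} \<times> {..<d - 1}) y" for x y
  proof (rule dim_generic_family_le[OF that _ _])
    fix vj assume vj: "vj \<in> {1..n} \<times> {..<d - 1}"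
    then obtain v j where "vj = (v, j)" "j < d" by auto
    then show "rigidity_row d n K vj z S = 0" if "S \<notin> Pow {1..n}" for z S
      using that rigidity_row_support(2)[of d j n K v z S] d by auto
    show "rat_polyfun ({1..n} \<times> {..<d - 1}) (\<lambda>z. rigidity_row d n K vj z S)" for S
      using vj by (cases vj) (use rat_polyfun_rigidity_row in blast)
  qed auto
  show ?thesis
    unfolding rank_volume_rigidity_matrix[OF d]
    using assms(2,3) by (intro antisym *) (simp_all add: generic_map_def)
qed


section \<open>The exchange family\<close>

text \<open>The sets obtained from \<open>[d]\<close> by exchanging one element \<open>j \<noteq> 1\<close> for some \<open>k\<close>, where \<open>k = j\<close> is allowed and
  yields \<open>[d]\<close> itself.\<close>

definition exchange_family :: "nat \<Rightarrow> nat \<Rightarrow> nat set set" where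
  "exchange_family d n =
    {insert k ({1..d} - {j}) | j k. j \<in> {2..d} \<and> k \<in> {1..n} \<and> k \<notin> {1..d} - {j}}"

lemma exchange_family_cases:
  assumes "\<tau> \<in> exchange_family d n"
  obtains "\<tau> = {1..d}"
  | j k where "\<tau> = insert k ({1..d} - {j})" "j \<in> {2..d}" "k \<in> {Suc d..n}"
proof -
  obtain j k where jk: "\<tau> = insert k ({1..d} - {j})" "j \<in> {2..d}" "k \<in> {1..n}" "k \<notin> {1..d} - {j}"
    using assms unfolding exchange_family_def by blast
  show thesis
  proof (cases "k = j")
    case True
    then have "\<tau> = {1..d}" using jk by auto
    then show thesis by (rule that(1))
  next
    case False
    then have "k \<in> {Suc d..n}" using jk(3,4) by auto
    then show thesis by (rule that(2)[OF jk(1,2)])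
  qed
qed

lemma exchange_family_eq:
  assumes "2 \<le> d" "d \<le> n"
  shows "exchange_family d n =
    insert {1..d} ((\<lambda>(j, k). insert k ({1..d} - {j})) ` ({2..d} \<times> {Suc d..n}))"
proof (intro equalityI subsetI)
  fix \<tau> assume "\<tau> \<in> exchange_family d n"
  then show "\<tau> \<in> insert {1..d} ((\<lambda>(j, k). insert k ({1..d} - {j})) ` ({2..d} \<times> {Suc d..n}))"
  proof (cases rule: exchange_family_cases)
    case (2 j k)
    then show ?thesis by (intro insertI2 image_eqI[of _ _ "(j, k)"]) auto
  qed simp
next
  fix \<tau> assume "\<tau> \<in> insert {1..d} ((\<lambda>(j, k). insert k ({1..d} - {j})) ` ({2..d} \<times> {Suc d..n}))"
  then show "\<tau> \<in> exchange_family d n"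
  proof
    assume "\<tau> = {1..d}"
    then have "\<tau> = insert 2 ({1..d} - {2})" "(2::nat) \<in> {2..d}" "(2::nat) \<in> {1..n}" "(2::nat) \<notin> {1..d} - {2}"
      using assms by auto
    then show ?thesis unfolding exchange_family_def by blast
  next
    assume "\<tau> \<in> (\<lambda>(j, k). insert k ({1..d} - {j})) ` ({2..d} \<times> {Suc d..n})"
    then obtain j k where "\<tau> = insert k ({1..d} - {j})" "j \<in> {2..d}" "k \<in> {Suc d..n}" by auto
    moreover from this have "k \<in> {1..n}" "k \<notin> {1..d} - {j}" using assms by auto
    ultimately show ?thesis unfolding exchange_family_def by blast
  qed
qed

lemma finite_exchange_family: "2 \<le> d \<Longrightarrow> d \<le> n \<Longrightarrow> finite (exchange_family d n)"
  by (simp add: exchange_family_eq)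

lemma card_exchange_family:
  assumes "2 \<le> d" "d \<le> n"
  shows "card (exchange_family d n) = 1 + (d - 1) * (n - d)"
proof -
  let ?h = "\<lambda>(j, k). insert k ({1..d} - {j})"
  have inj: "inj_on ?h ({2..d} \<times> {Suc d..n})"
  proof (rule inj_onI, clarify)
    fix j k j' k' assume *: "j \<in> {2..d}" "k \<in> {Suc d..n}" "j' \<in> {2..d}" "k' \<in> {Suc d..n}"
      and eq: "insert k ({1..d} - {j}) = insert k' ({1..d} - {j'})"
    have "j \<notin> insert k' ({1..d} - {j'})" unfolding eq[symmetric] using * by auto
    then have "j = j'" using * by auto
    moreover have "k \<in> insert k' ({1..d} - {j'})" using eq by blast
    then have "k = k'" using * by auto
    ultimately show "j = j' \<and> k = k'" by simp
  qed
  have "{1..d} \<notin> ?h ` ({2..d} \<times> {Suc d..n})"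
  proof
    assume "{1..d} \<in> ?h ` ({2..d} \<times> {Suc d..n})"
    then obtain j k where "{1..d} = insert k ({1..d} - {j})" "k \<in> {Suc d..n}" by auto
    then have "k \<in> {1..d}" by blast
    then show False using \<open>k \<in> {Suc d..n}\<close> by simp
  qed
  then show ?thesis
    unfolding exchange_family_eq[OF assms] using card_image[OF inj] by simp
qed

lemma exchange_family_subset: "\<tau> \<in> exchange_family d n \<Longrightarrow> d \<le> n \<Longrightarrow> \<tau> \<subseteq> {1..n}"
  unfolding exchange_family_def by auto

text \<open>The family depends only on the flag \<open>{1} \<subseteq> [d] \<subseteq> [n]\<close>.\<close>

lemma exchange_family_permute:
  assumes "inj \<pi>" "\<pi> ` {1..d} = {1..d}" "\<pi> ` {2..d} \<subseteq> {2..d}" "\<pi> ` {1..n} \<subseteq> {1..n}"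
    and "\<tau> \<in> exchange_family d n"
  shows "\<pi> ` \<tau> \<in> exchange_family d n"
proof -
  obtain j k where jk: "\<tau> = insert k ({1..d} - {j})" "j \<in> {2..d}" "k \<in> {1..n}" "k \<notin> {1..d} - {j}"
    using assms(5) unfolding exchange_family_def by blast
  have im: "\<pi> ` ({1..d} - {j}) = {1..d} - {\<pi> j}"
    using assms(2) by (simp add: image_set_diff[OF assms(1)])
  then have "\<pi> ` \<tau> = insert (\<pi> k) ({1..d} - {\<pi> j})" using jk(1) by simp
  moreover have "\<pi> k \<notin> {1..d} - {\<pi> j}"
    using jk(4) inj_image_mem_iff[OF assms(1), of k "{1..d} - {j}"] unfolding im by simp
  moreover have "\<pi> j \<in> {2..d}" "\<pi> k \<in> {1..n}" using assms(3,4) jk(2,3) by blast+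
  ultimately show ?thesis unfolding exchange_family_def by blast
qed


section \<open>Generic bases\<close>

definition basis_at :: "(nat \<times> nat \<Rightarrow> real) \<Rightarrow> nat \<Rightarrow> nat \<Rightarrow> real" where
  "basis_at x i = (if i = 1 then (\<lambda>_. 1) else (\<lambda>v. x (i, v)))"

lemma rat_polyfun_ext_family:
  assumes "\<tau> \<subseteq> {1..n}"
  shows "rat_polyfun ({2..n} \<times> {1..n}) (\<lambda>x. ext_family n (basis_at x) \<tau> S)"
proof -
  have fin: "finite \<tau>" using assms finite_subset by blast
  have "rat_polyfun ({2..n} \<times> {1..n})
     (\<lambda>x. wedge_list n (map (\<lambda>g. g x) (map (\<lambda>i x. basis_at x i) (sorted_list_of_set \<tau>))) S)"
  proof (rule rat_polyfun_wedge_list)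
    fix g v assume "g \<in> set (map (\<lambda>i x. basis_at x i) (sorted_list_of_set \<tau>))" and v: "v \<in> {1..n}"
    then obtain i where i: "i \<in> \<tau>" "g = (\<lambda>x. basis_at x i)" using fin by auto
    show "rat_polyfun ({2..n} \<times> {1..n}) (\<lambda>x. g x v)"
    proof (cases "i = 1")
      case True
      then show ?thesis by (simp add: i basis_at_def rat_polyfun_1)
    next
      case False
      then have "(i, v) \<in> {2..n} \<times> {1..n}" using assms i v by force
      then show ?thesis using False rat_polyfun_var[of "(i, v)" "{2..n} \<times> {1..n}"]
        by (simp add: i basis_at_def)
    qed
  qed
  then show ?thesis by (simp add: ext_family_eq_wedge_list comp_def)
qed

lemma sorted_list_of_set_1_atMost: "sorted_list_of_set {1..m} = [1..<Suc m]"
  by (simp only: atLeastLessThanSuc_atLeastAtMost[symmetric] sorted_list_of_set_range)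

text \<open>A coefficient of \<open>f\<^sub>1 \<and> \<dots> \<and> f\<^sub>m\<close> is a polynomial in the coordinates. It is not the zero polynomial,
  because at the point where \<open>f\<^sub>a\<close>, \<open>a \<ge> 2\<close>, is the indicator of the \<open>a\<close>-th element of \<open>s\<close>, the minor is
  upper triangular with ones on the diagonal.\<close>

lemma generic_ext_family_initial_nonzero:
  assumes x: "alg_indep_family ({2..n} \<times> {1..n}) x"
    and s: "sorted_wrt (<) s" "set s \<subseteq> {1..n}"
  shows "ext_family n (basis_at x) {1..length s} (set s) \<noteq> 0"
proof
  let ?m = "length s"
  assume zero: "ext_family n (basis_at x) {1..?m} (set s) = 0"
  have dist: "distinct s" using s(1) strict_sorted_iff by blast
  then have "?m \<le> n" using s(2) by (metis card_atLeastAtMost card_mono diff_Suc_1 distinct_card finite_atLeastAtMost)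
  then have sub: "{1..?m} \<subseteq> {1..n}" by auto
  define y :: "nat \<times> nat \<Rightarrow> real" where "y = (\<lambda>(i, v). of_bool (v = s ! (i - 1)))"
  let ?A = "coordinate_minor (map (basis_at y) [1..<Suc ?m]) s"
  have A: "?A \<in> carrier_mat ?m ?m" by (simp add: coordinate_minor_def del: upt_Suc)
  have entry: "?A $$ (a, b) = (if a = 0 then 1 else of_bool (a = b))" if "a < ?m" "b < ?m" for a b
    using that dist by (simp add: coordinate_minor_def basis_at_def y_def nth_eq_iff_index_eq del: upt_Suc)
  have "upper_triangular ?A" using A entry by (auto simp: upper_triangular_def)
  then have "det ?A = prod_list (diag_mat ?A)" by (rule det_upper_triangular[OF _ A])
  also have "diag_mat ?A = replicate ?m 1"
    using A entry by (intro nth_equalityI) (auto simp: diag_mat_def)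
  finally have "det ?A = 1" by simp
  moreover have "ext_family n (basis_at y) {1..?m} (set s) = det ?A"
    unfolding ext_family_eq_wedge_list sorted_list_of_set_1_atMost
    by (rule wedge_list_eq_det) (use s in \<open>auto simp del: upt_Suc\<close>)
  moreover have "ext_family n (basis_at y) {1..?m} (set s) = 0"
    using rat_polyfun_zero_if_zero_at_generic[OF x rat_polyfun_ext_family[OF sub] zero] .
  ultimately show False by simp
qed

text \<open>A generic family with \<open>f\<^sub>1 = \<one>\<close> is a basis of \<open>\<real>\<^sup>n\<close>: its coordinate matrix has nonzero determinant, and
  the adjugate matrix gives the coefficients.\<close>

lemma unit_vector_in_generic_span:
  assumes x: "alg_indep_family ({2..n} \<times> {1..n}) x" and v: "v \<in> {1..n}"
  shows "\<exists>c. ext_vector n (\<lambda>w. of_bool (w = v))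
    = (\<Sum>k\<in>{1..n}. ext_scale (c k) (ext_vector n (basis_at x k)))"
proof -
  let ?s = "[1..<Suc n]"
  define A where "A = coordinate_minor (map (basis_at x) ?s) ?s"
  have A: "A \<in> carrier_mat n n" by (simp add: A_def coordinate_minor_def del: upt_Suc)
  have entry: "A $$ (a, b) = basis_at x (Suc a) (Suc b)" if "a < n" "b < n" for a b
    using that by (simp add: A_def coordinate_minor_def del: upt_Suc)
  have "ext_family n (basis_at x) {1..length ?s} (set ?s) \<noteq> 0"
    by (rule generic_ext_family_initial_nonzero[OF x]) (auto simp del: upt_Suc)
  moreover have "ext_family n (basis_at x) {1..length ?s} (set ?s) = det A"
    unfolding ext_family_eq_wedge_list sorted_list_of_set_1_atMost A_def
    using wedge_list_eq_det[of ?s n "map (basis_at x) [1..<Suc (length ?s)]"]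
    by (simp add: atLeastLessThanSuc_atLeastAtMost del: upt_Suc)
  ultimately have det: "det A \<noteq> 0" by simp
  define c where "c k = adj_mat A $$ (v - 1, k - 1) / det A" for k
  have "(\<Sum>k\<in>{1..n}. c k * basis_at x k w) = of_bool (w = v)" if w: "w \<in> {1..n}" for w
  proof -
    have lt: "v - 1 < n" "w - 1 < n" using v w by auto
    have eq: "v - 1 = w - 1 \<longleftrightarrow> w = v" using v w by auto
    have "(\<Sum>k\<in>{1..n}. c k * basis_at x k w) = (\<Sum>a<n. c (Suc a) * basis_at x (Suc a) w)"
      by (simp only: One_nat_def sum.atLeast1_atMost_eq)
    also have "\<dots> = (\<Sum>a<n. adj_mat A $$ (v - 1, a) * A $$ (a, w - 1)) / det A"
      unfolding sum_divide_distrib by (rule sum.cong) (use w in \<open>auto simp: c_def entry\<close>)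
    also have "(\<Sum>a<n. adj_mat A $$ (v - 1, a) * A $$ (a, w - 1)) = (adj_mat A * A) $$ (v - 1, w - 1)"
      using A adj_mat(1)[OF A] lt by (simp add: scalar_prod_def atLeast0LessThan)
    also have "\<dots> = det A * of_bool (w = v)"
      unfolding adj_mat(3)[OF A] using lt eq by simp
    finally show ?thesis using det by simp
  qed
  then have "ext_vector n (\<lambda>w. of_bool (w = v)) = ext_vector n (\<lambda>w. \<Sum>k\<in>{1..n}. c k * basis_at x k w)"
    by (intro ext_vector_cong) simp
  also have "\<dots> = (\<Sum>k\<in>{1..n}. ext_scale (c k) (ext_vector n (basis_at x k)))"
    unfolding ext_vector_def
    by (simp add: fun_eq_iff sum_ext_apply ext_scale_apply sum_distrib_left sum_distrib_right mult.assoc)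
       (subst sum.swap, simp)
  finally show ?thesis by blast
qed


section \<open>Volume rigidity as linear independence\<close>

text \<open>Row \<open>j\<close> of the coordinate matrix is \<open>f\<^bsub>j+2\<^esub>\<close>, and \<open>f\<^sub>1\<close> comes last.\<close>

lemma exchange_list:
  assumes "2 \<le> d" "j < d - 1"
  shows "distinct (delete_nth j ([2..<Suc d] @ [1]))"
    "set (delete_nth j ([2..<Suc d] @ [1])) = {1..d} - {j + 2}"
proof -
  let ?l = "[2..<Suc d] @ [1::nat]"
  have l: "distinct ?l" "j < length ?l" "?l ! j = j + 2" "set ?l = {1..d}"
    using assms by (auto simp: nth_append simp del: upt_Suc)
  show "distinct (delete_nth j ?l)" "set (delete_nth j ?l) = {1..d} - {j + 2}"
    using distinct_delete_nth[OF l(1,2)] l(3,4) by simp_all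
qed

text \<open>Both sides equal the span of all \<open>K\<close>-parts of \<open>a \<and> P\<^sub>j\<close> with a vector \<open>a\<close>: the left side uses the unit
  vectors for \<open>a\<close>, the right side the basis \<open>f\<^sub>1, \<dots>, f\<^sub>n\<close>. With \<open>a = f\<^sub>k\<close> the product is \<open>0\<close> if \<open>f\<^sub>k\<close> already
  occurs in \<open>P\<^sub>j\<close>, and up to sign one of the \<open>f\<^sub>\<tau>\<close> otherwise.\<close>

lemma span_rigidity_rows:
  assumes x: "alg_indep_family ({2..n} \<times> {1..n}) x" and d: "2 \<le> d" "d \<le> n"
    and y: "coordinate_rows d y = map (basis_at x) ([2..<Suc d] @ [1])"
  shows "ext.span ((\<lambda>vj. rigidity_row d n K vj y) ` ({1..n} \<times> {..<d - 1}))
    = ext.span ((\<lambda>\<tau>. face_part K (ext_family n (basis_at x) \<tau>)) ` exchange_family d n)"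
    (is "ext.span ?R = ext.span ?S")
proof (rule antisym)
  let ?f = "basis_at x"
  define l where "l j = delete_nth j ([2..<Suc d] @ [1::nat])" for j
  define W where "W a j = face_part K (wedge (ext_vector n a) (wedge_list n (map ?f (l j))))" for a j
  have row: "rigidity_row d n K (v, j) y = W (\<lambda>w. of_bool (w = v)) j" for v j
    by (simp only: rigidity_row_def y W_def l_def map_delete_nth[symmetric] fst_conv snd_conv wedge_list_simps)
  have l: "distinct (l j)" "set (l j) = {1..d} - {j + 2}" if "j < d - 1" for j
    using exchange_list[OF d(1) that] by (simp_all add: l_def)
  have W: "eq_up_to_sign (W (?f k) j) (face_part K (ext_family n ?f (insert k ({1..d} - {j + 2}))))"
    if "j < d - 1" "k \<notin> set (l j)" for k j
  proof -
    have "distinct (k # l j)" using l(1)[OF that(1)] that(2) by simp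
    from wedge_list_eq_ext_family[OF this, of n ?f] show ?thesis
      using l(2)[OF that(1)] unfolding W_def by (intro face_part_eq_up_to_sign) simp
  qed
  show "ext.span ?R \<subseteq> ext.span ?S"
  proof (rule ext.span_minimal)
    have "rigidity_row d n K (v, j) y \<in> ext.span ?S" if v: "v \<in> {1..n}" and j: "j < d - 1" for v j
    proof -
      obtain c where c: "ext_vector n (\<lambda>w. of_bool (w = v)) = (\<Sum>k\<in>{1..n}. ext_scale (c k) (ext_vector n (?f k)))"
        using unit_vector_in_generic_span[OF x v] by blast
      have "rigidity_row d n K (v, j) y = (\<Sum>k\<in>{1..n}. ext_scale (c k) (W (?f k) j))"
        unfolding row W_def c wedge_sum_left face_part_sum wedge_scale_left face_part_scale ..
      also have "\<dots> \<in> ext.span ?S"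
      proof (intro ext.span_sum ext.span_scale)
        fix k assume k: "k \<in> {1..n}"
        show "W (?f k) j \<in> ext.span ?S"
        proof (cases "k \<in> set (l j)")
          case True
          then have "?f k \<in> set (map ?f (l j))" by simp
          from wedge_list_repeated[OF this, of n] have "W (?f k) j = 0" by (simp add: W_def)
          then show ?thesis by (simp add: ext.span_zero)
        next
          case False
          then have "k \<notin> {1..d} - {j + 2}" using l(2)[OF j] by simp
          moreover have "j + 2 \<in> {2..d}" using j by auto
          ultimately have "insert k ({1..d} - {j + 2}) \<in> exchange_family d n"
            using k unfolding exchange_family_def by blast
          then show ?thesis
            by (intro eq_up_to_sign_in_span[OF W[OF j False]] ext.span_base imageI)
        qed
      qed
      finally show ?thesis .
    qed
    then show "?R \<subseteq> ext.span ?S" by auto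
  qed simp
  show "ext.span ?S \<subseteq> ext.span ?R"
  proof (rule ext.span_minimal)
    have "face_part K (ext_family n ?f \<tau>) \<in> ext.span ?R" if \<tau>: "\<tau> \<in> exchange_family d n" for \<tau>
    proof -
      obtain i k where ik: "\<tau> = insert k ({1..d} - {i})" "i \<in> {2..d}" "k \<in> {1..n}" "k \<notin> {1..d} - {i}"
        using \<tau> unfolding exchange_family_def by blast
      define j where "j = i - 2"
      have j: "j < d - 1" "i = j + 2" using ik(2) by (auto simp: j_def)
      have "W (?f k) j = (\<Sum>v\<in>{1..n}. ext_scale (?f k v) (rigidity_row d n K (v, j) y))"
        unfolding W_def ext_vector_def[of n "?f k"] wedge_sum_left face_part_sum wedge_scale_left face_part_scale
        by (rule sum.cong) (simp_all add: row W_def ext_vector_unit)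
      also have "\<dots> \<in> ext.span ?R"
        using j(1) by (intro ext.span_sum ext.span_scale ext.span_base) auto
      finally have "W (?f k) j \<in> ext.span ?R" .
      moreover have "k \<notin> set (l j)" using l(2)[OF j(1)] ik(4) j(2) by simp
      ultimately show ?thesis
        using eq_up_to_sign_in_span[OF eq_up_to_sign_sym[OF W[OF j(1)]]] ik(1) j(2) by blast
    qed
    then show "?S \<subseteq> ext.span ?R" by auto
  qed simp
qed

text \<open>The rank may be computed at the generic positions given by \<open>f\<^sub>2, \<dots>, f\<^sub>d\<close>. It is the dimension of the
  span of the exchange family, which has as many members as the required rank.\<close>

lemma volume_rigid_iff_independent:
  fixes K :: "nat set set"
  assumes x: "alg_indep_family ({2..n} \<times> {1..n}) x" and d: "2 \<le> d" "d \<le> n"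
  defines "\<Phi> \<equiv> \<lambda>\<tau>. face_part K (ext_family n (basis_at x) \<tau>)"
  shows "volume_rigid d n K \<longleftrightarrow>
    (\<forall>\<rho>\<in>exchange_family d n. \<Phi> \<rho> \<notin> ext.span (\<Phi> ` (exchange_family d n - {\<rho>})))"
proof -
  define p where "p v = vec (d - 1) (\<lambda>j. x (j + 2, v))" for v
  have "alg_indep_family ({1..n} \<times> {..<d - 1}) (\<lambda>vj. x (snd vj + 2, fst vj))"
    by (rule alg_indep_family_reindex[OF x, of "\<lambda>vj. (snd vj + 2, fst vj)"])
       (use d in \<open>auto simp: inj_on_def\<close>)
  then have "alg_indep_family ({1..n} \<times> {..<d - 1}) (\<lambda>(v, j). p v $ j)"
    by (rule alg_indep_family_cong) (auto simp: p_def)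
  then have p: "generic_map d n p" by (simp add: generic_map_def p_def)
  have "coordinate_rows d (\<lambda>(v, j). p v $ j) = map (basis_at x) (map (\<lambda>j. j + 2) [0..<d - 1] @ [1])"
    by (simp add: coordinate_rows_def basis_at_def p_def)
  also have "map (\<lambda>j. j + 2) [0..<d - 1] = [2..<Suc d]"
    using d(1) map_add_upt[of 2 "d - 1"] by (simp del: upt_Suc)
  finally have rows: "coordinate_rows d (\<lambda>(v, j). p v $ j) = map (basis_at x) ([2..<Suc d] @ [1])" .
  have rank: "vec_space.rank ((d - 1) * n) (volume_rigidity_matrix d n K p) = ext.dim (\<Phi> ` exchange_family d n)"
    unfolding rank_volume_rigidity_matrix[OF d(1)] \<Phi>_def
    by (rule ext.span_eq_dim[OF span_rigidity_rows[OF x d rows]])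
  \<comment> \<open>Substituting \<open>n = d + e\<close> and \<open>d = c + 2\<close> removes the truncated subtractions from the count.\<close>
  obtain e where e: "n = d + e" using d(2) le_Suc_ex by blast
  obtain c where c: "d = c + 2" using d(1) le_Suc_ex by (metis add.commute)
  have target: "(int d - 1) * int n - ((int d)\<^sup>2 - int d - 1) = int (card (exchange_family d n))"
    unfolding card_exchange_family[OF d]
    unfolding e c by (simp add: power2_eq_square algebra_simps)
  have "volume_rigid d n K \<longleftrightarrow>
      int (vec_space.rank ((d - 1) * n) (volume_rigidity_matrix d n K p)) = int (card (exchange_family d n))"
    unfolding volume_rigid_def target
    using p rank_volume_rigidity_matrix_generic[OF d(1)] by metis
  also have "\<dots> \<longleftrightarrow> ext.dim (\<Phi> ` exchange_family d n) = card (exchange_family d n)"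
    unfolding rank by simp
  also have "\<dots> \<longleftrightarrow> (\<forall>\<rho>\<in>exchange_family d n. \<Phi> \<rho> \<notin> ext.span (\<Phi> ` (exchange_family d n - {\<rho>})))"
    by (rule dim_image_eq_card_iff[OF finite_exchange_family[OF d]])
  finally show ?thesis .
qed


section \<open>Partial shifting as membership in a span\<close>

lemma subspace_ext_carrier: "ext.subspace (ext_carrier n)"
  unfolding ext.subspace_def ext_carrier_def
  by (auto simp: ext_scale_def) (metis add.left_neutral subsetD atLeastAtMost_iff)+

text \<open>A product with \<open>e\<^sub>S\<close> is supported on supersets of \<open>S\<close>, and supersets of nonfaces are nonfaces.\<close>

lemma nonface_ideal_eq:
  assumes K: "simplicial_complex n K"
  shows "nonface_ideal n K = {z \<in> ext_carrier n. face_part K z = 0}"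
proof
  have sub: "ext.subspace {z \<in> ext_carrier n. face_part K z = 0}"
    using subspace_ext_carrier[of n]
    by (auto simp: ext.subspace_def face_part_add face_part_scale ext.scale_zero_right simp del: zero_fun_apply)
  show "nonface_ideal n K \<subseteq> {z \<in> ext_carrier n. face_part K z = 0}"
    unfolding nonface_ideal_def
  proof (rule ext.span_minimal[OF _ sub], clarify)
    fix x S y assume xy: "x \<in> ext_carrier n" "y \<in> ext_carrier n" "S \<subseteq> {1..n}" "S \<notin> K"
    have *: "S \<subseteq> T \<and> T \<subseteq> {1..n}" if T: "wedge (wedge x (ext_basis S)) y T \<noteq> 0" for T
    proof -
      obtain A where A: "A \<subseteq> T" "wedge x (ext_basis S) A \<noteq> 0" "y (T - A) \<noteq> 0"
        using T by (rule wedge_nonzeroE)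
      obtain B where B: "B \<subseteq> A" "x B \<noteq> 0" "ext_basis S (A - B) \<noteq> 0"
        using A(2) by (rule wedge_nonzeroE)
      have "A - B = S" using B(3) by (simp add: ext_basis_def split: if_splits)
      moreover have "B \<subseteq> {1..n}" "T - A \<subseteq> {1..n}"
        using xy(1,2) A(3) B(2) unfolding ext_carrier_def by blast+
      ultimately show ?thesis using A(1) B(1) xy(3) by blast
    qed
    have "face_part K (wedge (wedge x (ext_basis S)) y) = 0"
    proof
      fix T
      have "wedge (wedge x (ext_basis S)) y T = 0" if "T \<in> K"
        using *[of T] that xy(4) K unfolding simplicial_complex_def by blast
      then show "face_part K (wedge (wedge x (ext_basis S)) y) T = 0 T"
        by (simp add: face_part_def)
    qed
    then show "wedge (wedge x (ext_basis S)) y \<in> ext_carrier n \<and>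
        face_part K (wedge (wedge x (ext_basis S)) y) = 0"
      using * unfolding ext_carrier_def by blast
  qed
  show "{z \<in> ext_carrier n. face_part K z = 0} \<subseteq> nonface_ideal n K"
  proof clarify
    fix z assume z: "z \<in> ext_carrier n" "face_part K z = 0"
    have zK: "z S = 0" if "S \<in> K" for S using fun_cong[OF z(2), of S] that by (simp add: face_part_def)
    have "z T = (\<Sum>S\<in>Pow {1..n} - K. ext_scale (z S) (ext_basis S)) T" for T
    proof -
      have "(\<Sum>S\<in>Pow {1..n} - K. ext_scale (z S) (ext_basis S)) T
          = (\<Sum>S\<in>Pow {1..n} - K. if S = T then z S else 0)"
        unfolding sum_ext_apply by (rule sum.cong) (auto simp: ext_scale_def ext_basis_def)
      also have "\<dots> = (if T \<in> Pow {1..n} - K then z T else 0)" by (simp add: sum.delta)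
      also have "\<dots> = z T" using zK z(1) by (auto simp: ext_carrier_def)
      finally show ?thesis by simp
    qed
    then have "z = (\<Sum>S\<in>Pow {1..n} - K. ext_scale (z S) (ext_basis S))" by blast
    also have "\<dots> \<in> nonface_ideal n K"
      unfolding nonface_ideal_def
    proof (intro ext.span_sum ext.span_scale ext.span_base CollectI)
      fix S assume S: "S \<in> Pow {1..n} - K"
      then have "finite S" using finite_subset by auto
      then have "ext_basis S = wedge (wedge (ext_basis {}) (ext_basis S)) (ext_basis {})"
        by (simp add: wedge_ext_basis ext_scale_def)
      moreover have "ext_basis {} \<in> ext_carrier n"
        by (auto simp: ext_carrier_def ext_basis_def)
      ultimately show "\<exists>x S' y. ext_basis S = wedge (wedge x (ext_basis S')) y \<and>
          x \<in> ext_carrier n \<and> y \<in> ext_carrier n \<and> S' \<subseteq> {1..n} \<and> S' \<notin> K"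
        using S by blast
    qed
    finally show "z \<in> nonface_ideal n K" .
  qed
qed

lemma face_quotient_eq_iff:
  assumes K: "simplicial_complex n K" and xy: "x \<in> ext_carrier n" "y \<in> ext_carrier n"
  shows "face_quotient n K x = face_quotient n K y \<longleftrightarrow> face_part K x = face_part K y"
proof
  have sub: "ext.subspace (nonface_ideal n K)" unfolding nonface_ideal_def by (rule ext.subspace_span)
  assume "face_quotient n K x = face_quotient n K y"
  moreover have "x \<in> face_quotient n K x"
    unfolding face_quotient_def using ext.subspace_0[OF sub] by force
  ultimately obtain z where "x = y + z" "z \<in> nonface_ideal n K"
    unfolding face_quotient_def by blast
  then show "face_part K x = face_part K y"
    by (simp only: nonface_ideal_eq[OF K] mem_Collect_eq face_part_add add_0_right)
next
  have sub: "ext.subspace (nonface_ideal n K)" unfolding nonface_ideal_def by (rule ext.subspace_span)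
  assume eq: "face_part K x = face_part K y"
  have *: "face_quotient n K x \<subseteq> face_quotient n K y"
    if "x \<in> ext_carrier n" "y \<in> ext_carrier n" "face_part K x = face_part K y" for x y
  proof
    fix w assume "w \<in> face_quotient n K x"
    then obtain z where z: "w = x + z" "z \<in> nonface_ideal n K" unfolding face_quotient_def by blast
    have "face_part K (x - y) = 0"
      using that(3) by (auto simp: face_part_def fun_eq_iff split: if_splits)
    then have "x - y \<in> nonface_ideal n K"
      unfolding nonface_ideal_eq[OF K] using ext.subspace_diff[OF subspace_ext_carrier that(1,2)] by simp
    then have "(x - y) + z \<in> nonface_ideal n K" using z(2) ext.subspace_add[OF sub] by blast
    moreover have "w = y + ((x - y) + z)" using z(1) by (simp add: fun_eq_iff)
    ultimately show "w \<in> face_quotient n K y" unfolding face_quotient_def by blast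
  qed
  show "face_quotient n K x = face_quotient n K y"
    using *[OF xy eq] *[OF xy(2,1) eq[symmetric]] by blast
qed

lemma face_part_span_image: "face_part K ` ext.span B = ext.span (face_part K ` B)"
proof -
  interpret module_hom ext_scale ext_scale "face_part K"
    by unfold_locales (simp_all only: face_part_add face_part_scale)
  show ?thesis by (rule span_image[symmetric])
qed

lemma partial_shift_iff:
  assumes K: "simplicial_complex n K"
  shows "\<sigma> \<in> partial_shift n f K \<longleftrightarrow> \<sigma> \<subseteq> {1..n} \<and>
    face_part K (ext_family n f \<sigma>) \<notin> ext.span ((\<lambda>\<tau>. face_part K (ext_family n f \<tau>)) `
      {\<tau>. \<tau> \<subseteq> {1..n} \<and> less_p \<tau> \<sigma> \<and> card \<tau> = card \<sigma>})"
proof -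
  let ?T = "{\<tau>. \<tau> \<subseteq> {1..n} \<and> less_p \<tau> \<sigma> \<and> card \<tau> = card \<sigma>}"
  have "{ext_family n f \<tau> |\<tau>. \<tau> \<subseteq> {1..n} \<and> less_p \<tau> \<sigma> \<and> card \<tau> = card \<sigma>} = ext_family n f ` ?T"
    by blast
  moreover have carrier: "ext.span (ext_family n f ` ?T) \<subseteq> ext_carrier n"
    using subspace_ext_carrier ext_family_in_carrier by (intro ext.span_minimal) auto
  have "face_quotient n K (ext_family n f \<sigma>) \<in> face_quotient n K ` ext.span (ext_family n f ` ?T)
      \<longleftrightarrow> face_part K (ext_family n f \<sigma>) \<in> face_part K ` ext.span (ext_family n f ` ?T)"
    unfolding image_iff
    using carrier face_quotient_eq_iff[OF K ext_family_in_carrier] by (intro bex_cong refl) blast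
  ultimately show ?thesis
    by (simp add: partial_shift_def face_part_span_image image_image)
qed


section \<open>The sets below \<open>{1, 3, \<dots>, d, n}\<close>\<close>

lemma sorted_list_of_set_eqI:
  "sorted_wrt (<) l \<Longrightarrow> set l = A \<Longrightarrow> sorted_list_of_set A = (l :: nat list)"
  using sorted_list_of_set.idem_if_sorted_distinct[of l] strict_sorted_iff by blast

text \<open>The sorted list of the critical set is \<open>1, 3, 4, \<dots>, d, n\<close>. A set lies below it iff it starts with \<open>1\<close>
  and its first \<open>d - 1\<close> entries stay in \<open>[d]\<close>; so these entries are \<open>[d]\<close> with one \<open>j \<noteq> 1\<close> missing, and the
  last entry is free.\<close>

lemma le_p_iff_exchange:
  assumes d: "3 \<le> d" "d < n" and \<tau>: "\<tau> \<subseteq> {1..n}"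
  shows "le_p \<tau> (insert n ({1..d} - {2})) \<and> card \<tau> = card (insert n ({1..d} - {2}))
    \<longleftrightarrow> \<tau> \<in> exchange_family d n"
proof -
  let ?\<sigma> = "insert n ({1..d} - {2})"
  have fin: "finite \<tau>" using \<tau> finite_subset by blast
  have miss: "sorted_list_of_set (insert k ({1..d} - {j})) = [1..<j] @ [Suc j..<Suc d] @ [k]"
    if "j \<in> {2..d}" "k \<in> {Suc d..n}" for j k
    by (rule sorted_list_of_set_eqI) (use that in \<open>auto simp: sorted_wrt_append simp del: upt_Suc\<close>)
  have \<sigma>_nth: "sorted_list_of_set ?\<sigma> ! i = (if i = 0 then 1 else if i < d - 1 then i + 2 else n)"
    if "i < d" for i
    using miss[of 2 n] d that by (auto simp: nth_append simp del: upt_Suc)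
  have len\<sigma>: "length (sorted_list_of_set ?\<sigma>) = d" using miss[of 2 n] d by (simp del: upt_Suc)
  then have card\<sigma>: "card ?\<sigma> = d" by (simp only: length_sorted_list_of_set)
  show ?thesis
  proof
    assume L: "le_p \<tau> ?\<sigma> \<and> card \<tau> = card ?\<sigma>"
    define t where "t = sorted_list_of_set \<tau>"
    have t: "sorted_wrt (<) t" "set t = \<tau>" "distinct t" "length t = d"
      using fin L card\<sigma> by (auto simp: t_def)
    have le: "t ! i \<le> (if i = 0 then 1 else if i < d - 1 then i + 2 else n)" if "i < d" for i
      using L that \<sigma>_nth[OF that] len\<sigma> unfolding le_p_def t_def[symmetric]
      by (auto simp: list_all2_conv_all_nth)
    have ge: "t ! i \<in> {1..n}" if "i < d" for i using t that \<tau> nth_mem by blast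
    have t0: "t ! 0 = 1" using le[of 0] ge[of 0] d by auto
    let ?A = "set (take (d - 1) t)"
    have A: "?A \<subseteq> {1..d}"
    proof
      fix v assume "v \<in> ?A"
      then obtain i where i: "i < d - 1" "v = t ! i" using t(4) by (auto simp: in_set_conv_nth)
      then have "i < d" by simp
      then show "v \<in> {1..d}" using le[of i] ge[of i] i d by (cases "i = 0") auto
    qed
    have "card ?A = d - 1" using t by (simp add: distinct_card distinct_take)
    then have "card ({1..d} - ?A) = 1" using A d by (simp add: card_Diff_subset)
    then obtain j where j: "{1..d} - ?A = {j}" by (rule card_1_singletonE)
    then have A_eq: "?A = {1..d} - {j}" using A by blast
    have "t ! 0 \<in> ?A" using t(4) d by (subst in_set_conv_nth) (auto intro!: exI[of _ 0])
    then have "1 \<in> ?A" by (simp only: t0)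
    moreover have "j \<in> {1..d}" "j \<notin> ?A" using j by blast+
    ultimately have "j \<in> {1..d}" "j \<noteq> 1" by metis+
    then have j2: "j \<in> {2..d}" by simp
    have t_split: "t = take (d - 1) t @ [t ! (d - 1)]"
      using id_take_nth_drop[of "d - 1" t] t(4) d by simp
    have "set t = set (take (d - 1) t @ [t ! (d - 1)])" using t_split by (rule arg_cong)
    then have "\<tau> = insert (t ! (d - 1)) ?A" using t(2) by simp
    moreover have "distinct (take (d - 1) t @ [t ! (d - 1)])"
      using t(3) arg_cong[OF t_split, of distinct] by simp
    then have "t ! (d - 1) \<notin> ?A" by simp
    moreover have "t ! (d - 1) \<in> {1..n}" using ge[of "d - 1"] d by simp
    ultimately show "\<tau> \<in> exchange_family d n"
      using j2 unfolding A_eq exchange_family_def by blast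
  next
    assume \<tau>S: "\<tau> \<in> exchange_family d n"
    have *: "length (sorted_list_of_set \<tau>) = d \<and> (\<forall>i<d. sorted_list_of_set \<tau> ! i \<le>
        (if i = 0 then 1 else if i < d - 1 then i + 2 else n))"
      using \<tau>S
    proof (cases rule: exchange_family_cases)
      case 1
      then show ?thesis using d by (auto simp: sorted_list_of_set_1_atMost[unfolded One_nat_def] simp del: upt_Suc)
    next
      case (2 j k)
      have sorted: "sorted_list_of_set \<tau> = [1..<j] @ [Suc j..<Suc d] @ [k]"
        unfolding 2(1) by (rule miss[OF 2(2,3)])
      show ?thesis unfolding sorted using d 2(2,3) by (auto simp: nth_append simp del: upt_Suc)
    qed
    then show "le_p \<tau> ?\<sigma> \<and> card \<tau> = card ?\<sigma>"
      using \<sigma>_nth len\<sigma> card\<sigma> by (auto simp: le_p_def list_all2_conv_all_nth)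
  qed
qed


section \<open>Symmetry and the equivalence\<close>

text \<open>Write \<open>\<rho> = [d] - {j} \<union> {k}\<close>. The involution \<open>\<pi>\<close> that swaps \<open>2\<close> with \<open>j\<close> and \<open>k\<close> with \<open>n\<close> preserves the
  exchange family and carries the critical set to \<open>\<rho>\<close>. Permuting the basis vectors by \<open>\<pi>\<close> gives a generic
  basis for which the critical set plays the part of \<open>\<rho>\<close>, so that a bad relation for \<open>\<rho>\<close> transfers to one
  for the critical set.\<close>

lemma shift_membership_symmetric:
  fixes K :: "nat set set" and n :: nat
  assumes x: "alg_indep_family ({2..n} \<times> {1..n}) x" and d: "2 \<le> d" "d < n"
  defines "\<Phi> \<equiv> \<lambda>\<tau>. face_part K (ext_family n (basis_at x) \<tau>)"
  assumes \<sigma>: "\<Phi> (insert n ({1..d} - {2})) \<notin>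
      ext.span (\<Phi> ` (exchange_family d n - {insert n ({1..d} - {2})}))"
    and \<rho>: "\<rho> \<in> exchange_family d n" "\<rho> \<noteq> {1..d}"
  shows "\<Phi> \<rho> \<notin> ext.span (\<Phi> ` (exchange_family d n - {\<rho>}))"
proof
  let ?S = "exchange_family d n" and ?\<sigma> = "insert n ({1..d} - {2})"
  assume mem: "\<Phi> \<rho> \<in> ext.span (\<Phi> ` (?S - {\<rho>}))"
  obtain j k where jk: "\<rho> = insert k ({1..d} - {j})" "j \<in> {2..d}" "k \<in> {Suc d..n}"
    using \<rho>(1) by (rule exchange_family_cases) (use \<rho>(2) in blast)+
  define \<pi> where "\<pi> i = (if i = 2 then j else if i = j then 2 else if i = k then n else if i = n then k else i)" for i
  have inv: "\<pi> (\<pi> i) = i" for i using jk d by (auto simp: \<pi>_def)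
  then have inj: "inj \<pi>" by (metis injI)
  have \<pi>1: "\<pi> 1 = 1" "\<And>i. i \<noteq> 1 \<Longrightarrow> \<pi> i \<noteq> 1" using jk d by (auto simp: \<pi>_def)
  have sub: "\<pi> ` {1..d} \<subseteq> {1..d}" "\<pi> ` {2..d} \<subseteq> {2..d}" "\<pi> ` {1..n} \<subseteq> {1..n}" "\<pi> ` {2..n} \<subseteq> {2..n}"
    using jk d by (auto simp: \<pi>_def)
  have eqd: "\<pi> ` {1..d} = {1..d}"
  proof
    show "{1..d} \<subseteq> \<pi> ` {1..d}" using sub(1) inv by (metis image_eqI image_subset_iff subsetI)
  qed (rule sub(1))
  have inv': "\<pi> ` \<pi> ` \<tau> = \<tau>" for \<tau> by (simp add: image_image inv)
  have \<pi>S: "\<pi> ` \<tau> \<in> ?S" if "\<tau> \<in> ?S" for \<tau>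
    by (rule exchange_family_permute[OF inj eqd sub(2,3) that])
  have \<pi>\<sigma>: "\<pi> ` ?\<sigma> = \<rho>"
    using eqd jk by (simp add: image_set_diff[OF inj]) (simp add: \<pi>_def)
  have \<pi>_rest: "(`) \<pi> ` (?S - {?\<sigma>}) = ?S - {\<rho>}"
  proof (intro equalityI subsetI)
    fix \<tau> assume "\<tau> \<in> (`) \<pi> ` (?S - {?\<sigma>})"
    then show "\<tau> \<in> ?S - {\<rho>}" using \<pi>S inv' \<pi>\<sigma> by (metis DiffD1 DiffD2 DiffI imageE singletonD singletonI)
  next
    fix \<tau> assume \<tau>: "\<tau> \<in> ?S - {\<rho>}"
    then have "\<pi> ` \<tau> \<in> ?S - {?\<sigma>}" using \<pi>S inv' \<pi>\<sigma> by (metis DiffD1 DiffD2 DiffI singletonD singletonI)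
    then show "\<tau> \<in> (`) \<pi> ` (?S - {?\<sigma>})" using inv'[of \<tau>] by (metis imageI)
  qed
  define x' where "x' = (\<lambda>iv. x (\<pi> (fst iv), snd iv))"
  have x': "alg_indep_family ({2..n} \<times> {1..n}) x'"
    unfolding x'_def using sub(4) inj
    by (intro alg_indep_family_reindex[OF x, of "\<lambda>iv. (\<pi> (fst iv), snd iv)"]) (auto simp: inj_on_def inj_def)
  have basis: "basis_at x' = (\<lambda>i. basis_at x (\<pi> i))"
    using \<pi>1 by (auto simp: basis_at_def x'_def fun_eq_iff)
  define \<Phi>' where "\<Phi>' = (\<lambda>\<tau> z. face_part K (ext_family n (basis_at z) \<tau>))"
  have \<tau>sub: "\<tau> \<subseteq> {1..n}" if "\<tau> \<in> ?S" for \<tau> using exchange_family_subset that d by auto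
  have sign: "eq_up_to_sign (\<Phi>' \<tau> x') (\<Phi> (\<pi> ` \<tau>))" if "\<tau> \<in> ?S" for \<tau>
    unfolding \<Phi>'_def \<Phi>_def basis
    by (rule face_part_eq_up_to_sign[OF ext_family_permute[OF inj]])
       (rule finite_subset[OF \<tau>sub[OF that]], simp)
  have \<sigma>S: "?\<sigma> \<in> ?S" using d unfolding exchange_family_def by force
  have "\<Phi>' ?\<sigma> x' \<in> ext.span ((\<lambda>\<tau>. \<Phi>' \<tau> x') ` (?S - {?\<sigma>}))"
  proof (rule eq_up_to_sign_in_span[OF sign[OF \<sigma>S]])
    have "\<Phi> (\<pi> ` \<tau>) \<in> ext.span ((\<lambda>\<tau>. \<Phi>' \<tau> x') ` (?S - {?\<sigma>}))" if "\<tau> \<in> ?S - {?\<sigma>}" for \<tau>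
      using that by (intro eq_up_to_sign_in_span[OF eq_up_to_sign_sym[OF sign]] ext.span_base imageI) auto
    then have "\<Phi> ` (?S - {\<rho>}) \<subseteq> ext.span ((\<lambda>\<tau>. \<Phi>' \<tau> x') ` (?S - {?\<sigma>}))"
      unfolding \<pi>_rest[symmetric] by blast
    then have "ext.span (\<Phi> ` (?S - {\<rho>})) \<subseteq> ext.span ((\<lambda>\<tau>. \<Phi>' \<tau> x') ` (?S - {?\<sigma>}))"
      by (rule ext.span_minimal) simp
    then show "\<Phi> (\<pi> ` ?\<sigma>) \<in> ext.span ((\<lambda>\<tau>. \<Phi>' \<tau> x') ` (?S - {?\<sigma>}))"
      using mem unfolding \<pi>\<sigma> by blast
  qed
  then have "\<Phi>' ?\<sigma> x \<in> ext.span ((\<lambda>\<tau>. \<Phi>' \<tau> x) ` (?S - {?\<sigma>}))"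
  proof (rule span_membership_transfer[OF x' x, rotated -1])
    show "finite (?S - {?\<sigma>})" using finite_exchange_family d by simp
    show "finite (Pow {1..n})" by simp
    fix \<tau> assume "\<tau> \<in> insert ?\<sigma> (?S - {?\<sigma>})"
    then have \<tau>: "\<tau> \<subseteq> {1..n}" using \<tau>sub \<sigma>S by blast
    show "\<Phi>' \<tau> z S = 0" if "S \<notin> Pow {1..n}" for z S
      using that wedge_list_support[of n "map (basis_at z) (sorted_list_of_set \<tau>)" S]
      by (auto simp: \<Phi>'_def face_part_def ext_family_eq_wedge_list)
    show "rat_polyfun ({2..n} \<times> {1..n}) (\<lambda>z. \<Phi>' \<tau> z S)" for S
      unfolding \<Phi>'_def by (intro rat_polyfun_face_part rat_polyfun_ext_family \<tau>)
  qed
  then show False using \<sigma> by (simp add: \<Phi>'_def \<Phi>_def)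
qed

text \<open>Every \<open>\<tau> \<in> T\<close> contains \<open>2\<close>, so a wedge product with \<open>f\<^sub>2\<close> annihilates the span of the \<open>f\<^sub>\<tau>\<close>. It sends the
  remaining product to \<open>\<plusminus> f\<^sub>1 \<and> \<dots> \<and> f\<^sub>d\<close>, which is not zero.\<close>

lemma shift_of_simplex:
  assumes x: "alg_indep_family ({2..d} \<times> {1..d}) x" and d: "2 \<le> d"
    and K: "Pow {1..d} \<subseteq> K"
  defines "\<Phi> \<equiv> \<lambda>\<tau>. face_part K (ext_family d (basis_at x) \<tau>)"
  assumes T: "\<And>\<tau>. \<tau> \<in> T \<Longrightarrow> \<tau> \<subseteq> {1..d} \<and> card \<tau> = d - 1 \<and> \<tau> \<noteq> {1..d} - {2}"
  shows "\<Phi> ({1..d} - {2}) \<notin> ext.span (\<Phi> ` T)"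
proof
  let ?f = "basis_at x" and ?\<sigma> = "{1..d} - {2::nat}"
  let ?w = "wedge (ext_vector d (?f 2))"
  assume mem: "\<Phi> ?\<sigma> \<in> ext.span (\<Phi> ` T)"
  have \<Phi>: "\<Phi> \<tau> = ext_family d ?f \<tau>" for \<tau>
  proof
    fix S
    have "S \<in> K" if "ext_family d ?f \<tau> S \<noteq> 0"
      using ext_family_in_carrier[of d ?f \<tau>] that K unfolding ext_carrier_def by blast
    then show "\<Phi> \<tau> S = ext_family d ?f \<tau> S" by (auto simp: \<Phi>_def face_part_def)
  qed
  have sub: "ext.subspace {z. ?w z = 0}"
    by (auto simp: ext.subspace_def wedge_add_right wedge_scale_right wedge_zero_right
        ext.scale_zero_right simp del: zero_fun_apply)
  have "?w (\<Phi> \<tau>) = 0" if \<tau>: "\<tau> \<in> T" for \<tau>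
  proof -
    have "2 \<in> \<tau>"
    proof (rule ccontr)
      assume "2 \<notin> \<tau>"
      then have "\<tau> \<subseteq> ?\<sigma>" using T[OF \<tau>] by auto
      moreover have "card ?\<sigma> = d - 1" using d by simp
      ultimately have "\<tau> = ?\<sigma>" using T[OF \<tau>] by (intro card_subset_eq) auto
      then show False using T[OF \<tau>] by blast
    qed
    moreover have "finite \<tau>" using T[OF \<tau>] finite_subset by blast
    ultimately have "?f 2 \<in> set (map ?f (sorted_list_of_set \<tau>))" by simp
    from wedge_list_repeated[OF this, of d] show ?thesis
      by (simp only: \<Phi> ext_family_eq_wedge_list wedge_list_simps)
  qed
  then have "ext.span (\<Phi> ` T) \<subseteq> {z. ?w z = 0}"
    by (intro ext.span_minimal[OF _ sub]) auto
  then have zero: "?w (\<Phi> ?\<sigma>) = 0" using mem by blast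
  have "distinct (2 # sorted_list_of_set ?\<sigma>)" by simp
  from wedge_list_eq_ext_family[OF this, of d ?f]
  have "eq_up_to_sign (?w (\<Phi> ?\<sigma>)) (ext_family d ?f (insert 2 ?\<sigma>))"
    by (simp add: \<Phi> ext_family_eq_wedge_list)
  moreover have "insert 2 ?\<sigma> = {1..d}" using d by auto
  ultimately have "ext_family d ?f {1..d} = 0"
    using zero by (auto simp: eq_up_to_sign_def)
  moreover have "ext_family d ?f {1..length [1..<Suc d]} (set [1..<Suc d]) \<noteq> 0"
    by (rule generic_ext_family_initial_nonzero[OF x]) (auto simp del: upt_Suc)
  ultimately show False by (simp del: upt_Suc)
qed

lemma insert_eq_diff: "3 \<le> d \<Longrightarrow> {1} \<union> {3..d} \<union> {n} = insert n ({1..d} - {2::nat})"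
  by auto

theorem theorem1p2:
  fixes d n :: nat and K :: "nat set set" and f :: "nat \<Rightarrow> nat \<Rightarrow> real"
  assumes "d \<ge> 3"
    and "simplicial_complex n K"
    and "has_dimension K (d - 1)"
    and "generic_basis n f"
  shows "volume_rigid d n K \<longleftrightarrow> {1} \<union> {3..d} \<union> {n} \<in> partial_shift n f K"
proof -
  note d = assms(1) and K = assms(2)
  define x where "x = (\<lambda>(i, j). f i j)"
  have x: "alg_indep_family ({2..n} \<times> {1..n}) x" and f1: "\<forall>j\<in>{1..n}. f 1 j = 1"
    using assms(4) by (simp_all add: generic_basis_def x_def)
  define \<Phi> where "\<Phi> = (\<lambda>\<tau>. face_part K (ext_family n (basis_at x) \<tau>))"
  have family: "ext_family n f \<tau> = ext_family n (basis_at x) \<tau>" for \<tau>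
    using f1 by (intro ext_family_cong) (auto simp: basis_at_def x_def)
  obtain F where F: "F \<in> K" "card F = d" "F \<subseteq> {1..n}"
    using assms(1-3) unfolding has_dimension_def simplicial_complex_def by auto
  then have dn: "d \<le> n" by (metis card_atLeastAtMost card_mono diff_Suc_1 finite_atLeastAtMost)
  have finF: "finite F" using F(3) finite_subset by blast
  have \<Phi>d: "\<Phi> {1..d} \<noteq> 0"
  proof
    assume "\<Phi> {1..d} = 0"
    from fun_cong[OF this, of F] have "ext_family n (basis_at x) {1..d} F = 0"
      using F(1) by (simp add: \<Phi>_def face_part_def)
    then show False
      using generic_ext_family_initial_nonzero[OF x, of "sorted_list_of_set F"] F finF by simp
  qed
  let ?S = "exchange_family d n" and ?\<sigma> = "insert n ({1..d} - {2})"
  have rigid: "volume_rigid d n K \<longleftrightarrow> (\<forall>\<rho>\<in>?S. \<Phi> \<rho> \<notin> ext.span (\<Phi> ` (?S - {\<rho>})))"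
    unfolding \<Phi>_def using d by (intro volume_rigid_iff_independent[OF x _ dn]) simp
  have shift: "\<tau> \<in> partial_shift n f K \<longleftrightarrow> \<tau> \<subseteq> {1..n} \<and>
    \<Phi> \<tau> \<notin> ext.span (\<Phi> ` {\<rho>. \<rho> \<subseteq> {1..n} \<and> less_p \<rho> \<tau> \<and> card \<rho> = card \<tau>})" for \<tau>
    unfolding partial_shift_iff[OF K] family \<Phi>_def ..
  show ?thesis
  proof (cases "d = n")
    case True
    then have FK: "F = {1..d}" using F by (intro card_subset_eq) auto
    then have powK: "Pow {1..d} \<subseteq> K" using F(1) K unfolding simplicial_complex_def by blast
    have S: "?S = {{1..d}}" using exchange_family_eq[of d n] d True by auto
    have "volume_rigid d n K" unfolding rigid S using \<Phi>d by simp
    moreover have "{1} \<union> {3..d} \<union> {n} = {1..d} - {2}" using d True by auto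
    moreover have "{1..d} - {2} \<in> partial_shift n f K"
    proof -
      let ?T = "{\<rho>. \<rho> \<subseteq> {1..n} \<and> less_p \<rho> ({1..n} - {2}) \<and> card \<rho> = card ({1..n} - {2::nat})}"
      have "card ({1..n} - {2::nat}) = n - 1" using d True by simp
      then have "\<Phi> ({1..n} - {2}) \<notin> ext.span (\<Phi> ` ?T)"
        unfolding \<Phi>_def less_p_def using d True
        by (intro shift_of_simplex[OF x _ powK[unfolded True]]) simp_all
      then show ?thesis unfolding shift True by blast
    qed
    ultimately show ?thesis by simp
  next
    case False
    then have dn': "d < n" using dn by simp
    have \<sigma>S: "?\<sigma> \<in> ?S" using dn' d unfolding exchange_family_def by force
    have below: "{\<rho>. \<rho> \<subseteq> {1..n} \<and> less_p \<rho> ?\<sigma> \<and> card \<rho> = card ?\<sigma>} = ?S - {?\<sigma>}"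
      using le_p_iff_exchange[OF d dn'] exchange_family_subset[OF _ dn] unfolding less_p_def by blast
    have "?\<sigma> \<in> partial_shift n f K \<longleftrightarrow> \<Phi> ?\<sigma> \<notin> ext.span (\<Phi> ` (?S - {?\<sigma>}))"
      unfolding shift below using exchange_family_subset[OF \<sigma>S dn] by blast
    also have "\<dots> \<longleftrightarrow> (\<forall>\<rho>\<in>?S. \<Phi> \<rho> \<notin> ext.span (\<Phi> ` (?S - {\<rho>})))"
    proof
      assume \<sigma>: "\<Phi> ?\<sigma> \<notin> ext.span (\<Phi> ` (?S - {?\<sigma>}))"
      have others: "\<Phi> \<rho> \<notin> ext.span (\<Phi> ` (?S - {\<rho>}))" if "\<rho> \<in> ?S - {{1..d}}" for \<rho>
        using shift_membership_symmetric[OF x _ dn', of K \<rho>] \<sigma> that d unfolding \<Phi>_def by auto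
      have "{1..d} \<in> ?S" using exchange_family_eq[of d n] d dn by auto
      moreover have "finite ?S" using d dn by (intro finite_exchange_family) auto
      ultimately have "\<Phi> {1..d} \<notin> ext.span (\<Phi> ` (?S - {{1..d}}))"
        by (intro not_in_span_of_rest_if_others_not[OF _ _ \<Phi>d others])
      then show "\<forall>\<rho>\<in>?S. \<Phi> \<rho> \<notin> ext.span (\<Phi> ` (?S - {\<rho>}))" using others by blast
    qed (use \<sigma>S in blast)
    finally show ?thesis unfolding rigid insert_eq_diff[OF d] by blast
  qed
qed

end
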